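(* Every nonzero $\mathbf a\in\mathcal P^1_1$ has the strong anticupping property.
   Context: For $A,B\subseteq\mathbb N^{\mathbb N}$, $A\le^1_1B$ (Medvedev reducibility) means that there is a partial computable function $\Gamma:\subseteq\mathbb N^{\mathbb N}\to\mathbb N^{\mathbb N}$ defined on all of $B$ with $\Gamma(g)\in A$ for every $g\in B$. The $(1,1)$-degree of $A\subseteq\mathbb N^{\mathbb N}$ is its class under the equivalence $\equiv^1_1$ induced by $\le^1_1$; degrees are ordered by $\le^1_1$ on representatives. $\mathcal P^1_1$ is the set of $(1,1)$-degrees of nonempty $\Pi^0_1$ subsets of $2^{\mathbb N}$. The zero degree is the least degree (the degree of the sets containing a computable element), and the join $\mathbf b\vee\mathbf c$ of the degrees of $B$ and $C$ is the degree of $B\otimes C=\{f\oplus g:f\in B,\ g\in C\}$, where $(f\oplus g)(2n)=f(n)$ and $(f\oplus g)(2n+1)=g(n)$. A degree $\mathbf a\in\mathcal P^1_1$ has the strong anticupping property if there is a nonzero degree $\mathbf b\in\mathcal P^1_1$ such that, for any $(1,1)$-degree $\mathbf c$ (of an arbitrary subset of $\mathbb N^{\mathbb N}$), if $\mathbf a\le\mathbf b\vee\mathbf c$, then $\mathbf a\le\mathbf c$. *)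

theory Defs
  imports "HOL-Library.Nat_Bijection"
begin

text \<open>
  Partial recursive functions relative to an oracle \<open>g\<close>, all of them unary; further arguments are
  packed with the (primitive recursive) Cantor pairing \<^const>\<open>prod_encode\<close>.  \<open>Prec\<close> is primitive
  recursion on the second component and \<open>Mu\<close> is unbounded search.
\<close>

datatype code =
    Zero | Succ | Fst | Snd | Oracle
  | Pairing code code
  | Comp code code
  | Prec code code
  | Mu code

text \<open>\<open>eval g e x y\<close>: the program \<open>e\<close> with oracle \<open>g\<close> halts on input \<open>x\<close> with output \<open>y\<close>.\<close>

inductive eval :: "(nat \<Rightarrow> nat) \<Rightarrow> code \<Rightarrow> nat \<Rightarrow> nat \<Rightarrow> bool" for g :: "nat \<Rightarrow> nat" where
  Zero: "eval g Zero x 0"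
| Succ: "eval g Succ x (Suc x)"
| Fst: "eval g Fst x (fst (prod_decode x))"
| Snd: "eval g Snd x (snd (prod_decode x))"
| Oracle: "eval g Oracle x (g x)"
| Pairing: "eval g c x y \<Longrightarrow> eval g d x z \<Longrightarrow> eval g (Pairing c d) x (prod_encode (y, z))"
| Comp: "eval g d x y \<Longrightarrow> eval g c y z \<Longrightarrow> eval g (Comp c d) x z"
| Prec_0: "eval g c a y \<Longrightarrow> eval g (Prec c d) (prod_encode (a, 0)) y"
| Prec_Suc: "eval g (Prec c d) (prod_encode (a, n)) y \<Longrightarrow>
    eval g d (prod_encode (a, prod_encode (n, y))) z \<Longrightarrow>
    eval g (Prec c d) (prod_encode (a, Suc n)) z"
| Mu: "eval g c (prod_encode (a, k)) 0 \<Longrightarrow>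
    (\<forall>j<k. \<exists>m. eval g c (prod_encode (a, j)) (Suc m)) \<Longrightarrow> eval g (Mu c) a k"

inductive_cases eval_elims:
  "eval g Zero x y" "eval g Succ x y" "eval g Fst x y" "eval g Snd x y" "eval g Oracle x y"
  "eval g (Pairing c d) x y" "eval g (Comp c d) x y" "eval g (Mu c) x y"

inductive_cases eval_Prec_0E: "eval g (Prec c d) (prod_encode (a, 0)) y"
inductive_cases eval_Prec_SucE: "eval g (Prec c d) (prod_encode (a, Suc n)) y"

lemma eval_deterministic: "eval g e x y \<Longrightarrow> eval g e x z \<Longrightarrow> y = z"
proof (induction arbitrary: z rule: eval.induct)
  case (Prec_0 c a y d)
  from Prec_0.prems show ?case by (rule eval_Prec_0E) (auto intro: Prec_0.IH)
next
  case (Prec_Suc c d a n y z')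
  from Prec_Suc.prems show ?case
    by (rule eval_Prec_SucE) (auto dest: Prec_Suc.IH)
next
  case (Mu c a k)
  from Mu.prems obtain "eval g c (prod_encode (a, z)) 0"
    "\<forall>j<z. \<exists>m. eval g c (prod_encode (a, j)) (Suc m)" by (blast elim: eval_elims)
  with Mu.IH show ?case by (metis linorder_neqE_nat nat.distinct(1))
qed (blast elim: eval_elims)+

text \<open>
  By \<open>eval_deterministic\<close> every program \<open>e\<close> determines exactly one partial function on Baire space,
  defined at those oracles \<open>g\<close> for which \<open>e\<close> with oracle \<open>g\<close> halts on all inputs.
\<close>

definition partial_computable :: "((nat \<Rightarrow> nat) \<rightharpoonup> (nat \<Rightarrow> nat)) \<Rightarrow> bool" where
  "partial_computable \<Gamma> \<longleftrightarrow> (\<exists>e. \<forall>g f. \<Gamma> g = Some f \<longleftrightarrow> (\<forall>n. eval g e n (f n)))"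

definition computable :: "(nat \<Rightarrow> nat) \<Rightarrow> bool" where
  "computable f \<longleftrightarrow> (\<exists>e. \<forall>n. eval (\<lambda>_. 0) e n (f n))"

definition computable_relation :: "((nat \<Rightarrow> nat) \<Rightarrow> nat \<Rightarrow> bool) \<Rightarrow> bool" where
  "computable_relation R \<longleftrightarrow> (\<exists>e. \<forall>f n. eval f e n (of_bool (R f n)))"

definition pi01 :: "(nat \<Rightarrow> nat) set \<Rightarrow> bool" where
  "pi01 A \<longleftrightarrow> (\<exists>R. computable_relation R \<and> A = {f. \<forall>n. R f n})"

definition cantor_space :: "(nat \<Rightarrow> nat) set" where
  "cantor_space = {f. \<forall>n. f n \<in> {0, 1}}"

definition medvedev_le :: "(nat \<Rightarrow> nat) set \<Rightarrow> (nat \<Rightarrow> nat) set \<Rightarrow> bool" where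
  "medvedev_le A B \<longleftrightarrow>
    (\<exists>\<Gamma>. partial_computable \<Gamma> \<and> B \<subseteq> dom \<Gamma> \<and> (\<forall>g\<in>B. the (\<Gamma> g) \<in> A))"

definition medvedev_equiv :: "(nat \<Rightarrow> nat) set \<Rightarrow> (nat \<Rightarrow> nat) set \<Rightarrow> bool" where
  "medvedev_equiv A B \<longleftrightarrow> medvedev_le A B \<and> medvedev_le B A"

definition fun_join :: "(nat \<Rightarrow> nat) \<Rightarrow> (nat \<Rightarrow> nat) \<Rightarrow> nat \<Rightarrow> nat" where
  "fun_join f g n = (if even n then f (n div 2) else g (n div 2))"

definition set_join :: "(nat \<Rightarrow> nat) set \<Rightarrow> (nat \<Rightarrow> nat) set \<Rightarrow> (nat \<Rightarrow> nat) set" where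
  "set_join B C = {fun_join f g | f g. f \<in> B \<and> g \<in> C}"

lemma fun_join_simps [simp]: "fun_join f g (2 * n) = f n" "fun_join f g (2 * n + 1) = g n"
  by (simp_all add: fun_join_def)

lemma partial_computable_code:
  "\<exists>\<Gamma>. partial_computable \<Gamma> \<and> (\<forall>g f. \<Gamma> g = Some f \<longleftrightarrow> (\<forall>n. eval g e n (f n)))"
proof -
  define F where "F g f \<longleftrightarrow> (\<forall>n. eval g e n (f n))" for g f
  define \<Gamma> where "\<Gamma> g = (if \<exists>f. F g f then Some (SOME f. F g f) else None)" for g
  have F_unique: "f = f'" if "F g f" "F g f'" for g f f'
    using that unfolding F_def by (blast intro: eval_deterministic)
  have "\<Gamma> g = Some f \<longleftrightarrow> F g f" for g f
    unfolding \<Gamma>_def using someI[of "F g"] by (auto intro: F_unique)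
  then have "\<forall>g f. \<Gamma> g = Some f \<longleftrightarrow> (\<forall>n. eval g e n (f n))"
    by (simp add: F_def)
  then show ?thesis unfolding partial_computable_def by blast
qed

lemma medvedev_le_iff: "medvedev_le A B \<longleftrightarrow> (\<exists>e. \<forall>g\<in>B. \<exists>f\<in>A. \<forall>n. eval g e n (f n))"
proof
  assume "medvedev_le A B"
  then obtain \<Gamma> e where *: "\<And>g f. \<Gamma> g = Some f \<longleftrightarrow> (\<forall>n. eval g e n (f n))"
    and B: "B \<subseteq> dom \<Gamma>" "\<forall>g\<in>B. the (\<Gamma> g) \<in> A"
    unfolding medvedev_le_def partial_computable_def by blast
  have "\<exists>f\<in>A. \<forall>n. eval g e n (f n)" if "g \<in> B" for g
  proof -
    from that B obtain f where "\<Gamma> g = Some f" "f \<in> A" by fastforce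
    with * show ?thesis by blast
  qed
  then show "\<exists>e. \<forall>g\<in>B. \<exists>f\<in>A. \<forall>n. eval g e n (f n)" by blast
next
  assume "\<exists>e. \<forall>g\<in>B. \<exists>f\<in>A. \<forall>n. eval g e n (f n)"
  then obtain e where e: "\<forall>g\<in>B. \<exists>f\<in>A. \<forall>n. eval g e n (f n)" by blast
  obtain \<Gamma> where "partial_computable \<Gamma>" "\<forall>g f. \<Gamma> g = Some f \<longleftrightarrow> (\<forall>n. eval g e n (f n))"
    using partial_computable_code by blast
  moreover have "\<exists>f\<in>A. \<Gamma> g = Some f" if "g \<in> B" for g
    using calculation e that by blast
  then have "B \<subseteq> dom \<Gamma>" "\<forall>g\<in>B. the (\<Gamma> g) \<in> A" by (auto, force)
  ultimately show "medvedev_le A B" unfolding medvedev_le_def by blast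
qed

primrec subst_oracle :: "code \<Rightarrow> code \<Rightarrow> code" where
  "subst_oracle d Zero = Zero"
| "subst_oracle d Succ = Succ"
| "subst_oracle d Fst = Fst"
| "subst_oracle d Snd = Snd"
| "subst_oracle d Oracle = d"
| "subst_oracle d (Pairing c c') = Pairing (subst_oracle d c) (subst_oracle d c')"
| "subst_oracle d (Comp c c') = Comp (subst_oracle d c) (subst_oracle d c')"
| "subst_oracle d (Prec c c') = Prec (subst_oracle d c) (subst_oracle d c')"
| "subst_oracle d (Mu c) = Mu (subst_oracle d c)"

lemma eval_subst_oracle:
  assumes "eval f e x y" "\<And>n. eval g d n (f n)"
  shows "eval g (subst_oracle d e) x y"
  using assms(1)
proof induction
  case (Oracle x)
  then show ?case by (simp add: assms(2))
next
  case (Mu c a k)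
  then show ?case by (auto intro: eval.Mu)
qed (auto intro: eval.intros)

lemma eval_Fst' [intro]: "eval g Fst (prod_encode (x, y)) x"
  using eval.Fst[of g "prod_encode (x, y)"] by simp

lemma eval_Snd' [intro]: "eval g Snd (prod_encode (x, y)) y"
  using eval.Snd[of g "prod_encode (x, y)"] by simp

definition Ident :: code where "Ident = Pairing Fst Snd"

lemma eval_Ident: "eval g Ident x x"
  using eval.Pairing[OF eval.Fst eval.Snd, of g x] by (simp add: Ident_def)

definition Iter :: "code \<Rightarrow> code \<Rightarrow> code" where
  "Iter c d = Comp (Prec c (Comp d (Comp Snd Snd))) (Pairing Zero Ident)"

lemma eval_Iter:
  assumes "eval g c 0 (s 0)" "\<And>n. eval g d (s n) (s (Suc n))"
  shows "eval g (Iter c d) n (s n)"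
proof -
  have "eval g (Prec c (Comp d (Comp Snd Snd))) (prod_encode (0, n)) (s n)"
    by (induction n) (use assms in \<open>blast intro: eval.intros\<close>)+
  then show ?thesis
    unfolding Iter_def by (blast intro: eval.intros eval_Ident)
qed

lemma eval_double: "eval g (Iter Zero (Comp Succ Succ)) n (2 * n)"
proof (rule eval_Iter[where s = "\<lambda>n. 2 * n"])
  show "eval g Zero 0 (2 * 0)" by (simp add: eval.Zero)
  show "eval g (Comp Succ Succ) (2 * n) (2 * Suc n)" for n
    using eval.Comp[OF eval.Succ eval.Succ, of g "2 * n"] by simp
qed

lemma eval_half:
  "eval g (Comp Fst (Iter (Pairing Zero Zero) (Pairing Snd (Comp Succ Fst)))) n (n div 2)"
proof -
  have "eval g (Iter (Pairing Zero Zero) (Pairing Snd (Comp Succ Fst))) n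
      (prod_encode (n div 2, Suc n div 2))"
    by (rule eval_Iter[where s = "\<lambda>n. prod_encode (n div 2, Suc n div 2)"])
      (auto intro!: eval.intros)
  then show ?thesis by (blast intro: eval.intros)
qed

lemma eval_parity:
  "eval g (Comp Fst (Iter (Pairing Zero (Comp Succ Zero)) (Pairing Snd Fst))) n (n mod 2)"
proof -
  have "eval g (Iter (Pairing Zero (Comp Succ Zero)) (Pairing Snd Fst)) n
      (prod_encode (n mod 2, Suc n mod 2))"
  proof (rule eval_Iter[where s = "\<lambda>n. prod_encode (n mod 2, Suc n mod 2)"])
    show "eval g (Pairing Zero (Comp Succ Zero)) 0 (prod_encode (0 mod 2, Suc 0 mod 2))"
      by (auto intro!: eval.intros)
    show "eval g (Pairing Snd Fst) (prod_encode (n mod 2, Suc n mod 2))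
        (prod_encode (Suc n mod 2, Suc (Suc n) mod 2))" for n
      by (auto intro!: eval.Pairing)
  qed
  then show ?thesis by (blast intro: eval.intros)
qed

lemma medvedev_le_refl: "medvedev_le A A"
  unfolding medvedev_le_iff by (rule exI[of _ Oracle]) (auto intro: eval.intros)

lemma medvedev_le_trans:
  assumes "medvedev_le A B" "medvedev_le B C"
  shows "medvedev_le A C"
proof -
  from assms obtain c d where c: "\<forall>g\<in>B. \<exists>f\<in>A. \<forall>n. eval g c n (f n)"
    and d: "\<forall>g\<in>C. \<exists>f\<in>B. \<forall>n. eval g d n (f n)"
    unfolding medvedev_le_iff by blast
  have "\<exists>f\<in>A. \<forall>n. eval g (subst_oracle d c) n (f n)" if "g \<in> C" for g
    using c d that by (meson eval_subst_oracle)
  then show ?thesis unfolding medvedev_le_iff by blast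
qed

lemma medvedev_le_set_join1: "medvedev_le B (set_join B C)"
proof -
  have "eval (fun_join f h) (Comp Oracle (Iter Zero (Comp Succ Succ))) n (f n)" for f h n
    using eval.Comp[OF eval_double eval.Oracle, of "fun_join f h" n] by simp
  then show ?thesis unfolding medvedev_le_iff set_join_def by blast
qed

lemma medvedev_le_set_join2: "medvedev_le C (set_join B C)"
proof -
  have "eval (fun_join f h) (Comp Oracle (Comp Succ (Iter Zero (Comp Succ Succ)))) n (h n)" for f h n
    using eval.Comp[OF eval.Comp[OF eval_double eval.Succ] eval.Oracle, of "fun_join f h" n]
    by (metis Suc_eq_plus1 fun_join_simps(2))
  then show ?thesis unfolding medvedev_le_iff set_join_def by blast
qed

lemma set_join_medvedev_le:
  assumes "medvedev_le B A" "medvedev_le C A"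
  shows "medvedev_le (set_join B C) A"
proof -
  from assms obtain c d where c: "\<forall>g\<in>A. \<exists>f\<in>B. \<forall>n. eval g c n (f n)"
    and d: "\<forall>g\<in>A. \<exists>f\<in>C. \<forall>n. eval g d n (f n)"
    unfolding medvedev_le_iff by blast
  let ?half = "Comp Fst (Iter (Pairing Zero Zero) (Pairing Snd (Comp Succ Fst)))"
  let ?par = "Comp Fst (Iter (Pairing Zero (Comp Succ Zero)) (Pairing Snd Fst))"
  let ?e = "Comp (Prec c (Comp d Fst)) (Pairing ?half ?par)"
  have "\<exists>k\<in>set_join B C. \<forall>n. eval g ?e n (k n)" if g: "g \<in> A" for g
  proof -
    from c d g obtain f h where f: "f \<in> B" "\<And>n. eval g c n (f n)"
      and h: "h \<in> C" "\<And>n. eval g d n (h n)" by blast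
    have "eval g ?e n (fun_join f h n)" for n
    proof (rule eval.Comp)
      show "eval g (Pairing ?half ?par) n (prod_encode (n div 2, n mod 2))"
        by (intro eval.Pairing eval_half eval_parity)
      have 0: "eval g (Prec c (Comp d Fst)) (prod_encode (n div 2, 0)) (f (n div 2))"
        by (intro eval.Prec_0 f)
      have "eval g (Prec c (Comp d Fst)) (prod_encode (n div 2, Suc 0)) (h (n div 2))"
        by (rule eval.Prec_Suc[OF 0]) (blast intro: eval.Comp h)
      with 0 show "eval g (Prec c (Comp d Fst)) (prod_encode (n div 2, n mod 2)) (fun_join f h n)"
        by (cases "even n") (auto simp: fun_join_def odd_iff_mod_2_eq_one)
    qed
    with f h show ?thesis unfolding set_join_def by blast
  qed
  then show ?thesis unfolding medvedev_le_iff by blast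
qed

lemma computable_medvedev_le: "medvedev_le {f. computable f} A"
proof -
  have "computable (\<lambda>_. 0)" unfolding computable_def by (blast intro: eval.Zero)
  then show ?thesis
    unfolding medvedev_le_iff
    by (intro exI[of _ Zero] ballI bexI[of _ "\<lambda>_. 0"]) (auto intro: eval.Zero)
qed

quotient_type degree = "(nat \<Rightarrow> nat) set" / medvedev_equiv
  by (rule equivpI)
    (auto simp: reflp_def symp_def transp_def medvedev_equiv_def
      intro: medvedev_le_refl medvedev_le_trans)

instantiation degree :: "{semilattice_sup, order_bot}"
begin

lift_definition less_eq_degree :: "degree \<Rightarrow> degree \<Rightarrow> bool" is medvedev_le
  unfolding medvedev_equiv_def by (blast intro: medvedev_le_trans)

definition less_degree :: "degree \<Rightarrow> degree \<Rightarrow> bool" where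
  "less_degree a b \<longleftrightarrow> a \<le> b \<and> \<not> b \<le> a"

lift_definition sup_degree :: "degree \<Rightarrow> degree \<Rightarrow> degree" is set_join
  unfolding medvedev_equiv_def
  by (meson medvedev_le_set_join1 medvedev_le_set_join2 medvedev_le_trans set_join_medvedev_le)

lift_definition bot_degree :: degree is "{f. computable f}" .

instance
proof
  fix a b c :: degree
  show "a < b \<longleftrightarrow> a \<le> b \<and> \<not> b \<le> a" by (rule less_degree_def)
  show "a \<le> a" by transfer (rule medvedev_le_refl)
  show "a \<le> b \<Longrightarrow> b \<le> c \<Longrightarrow> a \<le> c" by transfer (rule medvedev_le_trans)
  show "a \<le> b \<Longrightarrow> b \<le> a \<Longrightarrow> a = b" by transfer (simp add: medvedev_equiv_def)
  show "a \<le> sup a b" by transfer (rule medvedev_le_set_join1)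
  show "b \<le> sup a b" by transfer (rule medvedev_le_set_join2)
  show "b \<le> a \<Longrightarrow> c \<le> a \<Longrightarrow> sup b c \<le> a" by transfer (rule set_join_medvedev_le)
  show "bot \<le> a" by transfer (rule computable_medvedev_le)
qed

end

lemma abs_degree_eq_bot_iff: "abs_degree A = bot \<longleftrightarrow> (\<exists>f\<in>A. computable f)"
proof -
  have "abs_degree A = bot \<longleftrightarrow> medvedev_le A {f. computable f}"
    by (metis bot_degree.abs_eq bot.extremum_unique less_eq_degree.abs_eq)
  also have "\<dots> \<longleftrightarrow> (\<exists>f\<in>A. computable f)"
  proof
    assume "medvedev_le A {f. computable f}"
    moreover have "computable (\<lambda>_. 0)" unfolding computable_def by (blast intro: eval.Zero)
    ultimately show "\<exists>f\<in>A. computable f"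
      unfolding medvedev_le_iff by (metis computable_def mem_Collect_eq)
  next
    assume "\<exists>f\<in>A. computable f"
    then obtain f e where f: "f \<in> A" "\<And>n. eval (\<lambda>_. 0) e n (f n)"
      unfolding computable_def by blast
    then have "eval g (subst_oracle Zero e) n (f n)" for g n
      by (blast intro: eval_subst_oracle eval.Zero)
    with f show "medvedev_le A {f. computable f}" unfolding medvedev_le_iff by blast
  qed
  finally show ?thesis .
qed

definition P11 :: "degree set" where
  "P11 = {abs_degree P | P. P \<noteq> {} \<and> P \<subseteq> cantor_space \<and> pi01 P}"

definition strong_anticupping :: "degree \<Rightarrow> bool" where
  "strong_anticupping a \<longleftrightarrow> (\<exists>b\<in>P11. b \<noteq> bot \<and> (\<forall>c. a \<le> sup b c \<longrightarrow> a \<le> c))"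

end

theory Submission
  imports Defs
begin

text \<open>
  Let \<open>P\<close> be a nonempty \<open>\<Pi>\<^sup>0\<^sub>1\<close> subset of Cantor space without computable elements, and let \<open>T\<close> be a
  computable tree whose paths are the elements of \<open>P\<close>.
  An element of \<open>Q\<close> runs through copies of \<open>T\<close>: whenever it leaves the current copy, its next bit
  is recorded, and a new copy is started; the string of recorded bits has to stay in \<open>T\<close>.  Either
  finitely many copies are used, and then a tail of the element is in \<open>P\<close>, or the recorded bits
  form an element of \<open>P\<close>.  Hence \<open>Q\<close> is a nonempty \<open>\<Pi>\<^sup>0\<^sub>1\<close> set without computable elements.

  Suppose that \<open>\<Gamma>\<close> maps \<open>g \<oplus> h\<close> into \<open>P\<close> for every \<open>g \<in> Q\<close>.  Since \<open>P\<close> has no computable element, every string in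
  \<open>T\<close> has an extension that leaves \<open>T\<close>, hence every string inside the current copy can be extended
  to an element of \<open>Q\<close>, as long as the recorded bits are extendible to an element of \<open>P\<close>.  So \<open>h\<close>
  can search for a string that leaves the current copy and on which \<open>\<Gamma>\<close> outputs its next bit.  This
  bit is correct, and recording it in the next place keeps the recorded bits extendible: the
  recorded bits are the output of \<open>\<Gamma>\<close> and form an element of \<open>P\<close> computed from \<open>h\<close>.
\<close>

subsection \<open>Uniform computability\<close>

text \<open>A single program serves all oracles in \<open>X\<close> and has to halt only for these.
  The cancellation uses an arbitrary class \<open>C\<close> as \<open>X\<close>; the proof that
  \<open>Q\<close> has no computable element uses a singleton.\<close>

definition computable_on :: "(nat \<Rightarrow> nat) set \<Rightarrow> ((nat \<Rightarrow> nat) \<Rightarrow> nat \<Rightarrow> nat) \<Rightarrow> bool" where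
  "computable_on X F \<longleftrightarrow> (\<exists>c. \<forall>g\<in>X. \<forall>x. eval g c x (F g x))"

abbreviation pfst :: "nat \<Rightarrow> nat" where "pfst x \<equiv> fst (prod_decode x)"
abbreviation psnd :: "nat \<Rightarrow> nat" where "psnd x \<equiv> snd (prod_decode x)"

lemma computable_on_id: "computable_on X (\<lambda>g x. x)"
  unfolding computable_on_def using eval_Ident by blast

lemma computable_on_comp:
  "computable_on X F \<Longrightarrow> computable_on X A \<Longrightarrow> computable_on X (\<lambda>g x. F g (A g x))"
  unfolding computable_on_def by (meson eval.Comp)

lemma computable_on_Suc: "computable_on X A \<Longrightarrow> computable_on X (\<lambda>g x. Suc (A g x))"
  unfolding computable_on_def by (meson eval.Comp eval.Succ)

lemma computable_on_const: "computable_on X (\<lambda>g x. k)"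
proof (induction k)
  case 0
  then show ?case unfolding computable_on_def by (meson eval.Zero)
qed (rule computable_on_Suc)

lemma computable_on_pfst: "computable_on X A \<Longrightarrow> computable_on X (\<lambda>g x. pfst (A g x))"
  unfolding computable_on_def by (meson eval.Comp eval.Fst)

lemma computable_on_psnd: "computable_on X A \<Longrightarrow> computable_on X (\<lambda>g x. psnd (A g x))"
  unfolding computable_on_def by (meson eval.Comp eval.Snd)

lemma computable_on_oracle: "computable_on X A \<Longrightarrow> computable_on X (\<lambda>g x. g (A g x))"
  unfolding computable_on_def by (meson eval.Comp eval.Oracle)

lemma computable_on_pair:
  "computable_on X A \<Longrightarrow> computable_on X B \<Longrightarrow> computable_on X (\<lambda>g x. prod_encode (A g x, B g x))"
  unfolding computable_on_def by (meson eval.Pairing)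

lemma computable_on_comp2:
  assumes "computable_on X (\<lambda>g z. F g (pfst z) (psnd z))" "computable_on X A" "computable_on X B"
  shows "computable_on X (\<lambda>g x. F g (A g x) (B g x))"
  using computable_on_comp[OF assms(1) computable_on_pair[OF assms(2,3)]] by simp

lemma computable_on_rec:
  assumes N: "computable_on X N" and A: "computable_on X A"
    and B: "computable_on X (\<lambda>g z. B g (pfst z) (pfst (psnd z)) (psnd (psnd z)))"
  shows "computable_on X (\<lambda>g x. rec_nat (A g x) (B g x) (N g x))"
proof -
  from A B obtain a b where a: "\<And>g x. g \<in> X \<Longrightarrow> eval g a x (A g x)"
    and b: "\<And>g z. g \<in> X \<Longrightarrow> eval g b z (B g (pfst z) (pfst (psnd z)) (psnd (psnd z)))"
    unfolding computable_on_def by metis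
  have "eval g (Prec a b) (prod_encode (x, n)) (rec_nat (A g x) (B g x) n)" if "g \<in> X" for g x n
  proof (induction n)
    case 0
    then show ?case by (simp add: a that eval.Prec_0)
  next
    case (Suc n)
    from eval.Prec_Suc[OF this] b[OF that, of "prod_encode (x, prod_encode (n, rec_nat (A g x) (B g x) n))"]
    show ?case by simp
  qed
  then have "eval g (Prec a b) z (rec_nat (A g (pfst z)) (B g (pfst z)) (psnd z))" if "g \<in> X" for g z
    using that by (metis prod.collapse prod_decode_inverse)
  then have "computable_on X (\<lambda>g z. rec_nat (A g (pfst z)) (B g (pfst z)) (psnd z))"
    unfolding computable_on_def by blast
  from computable_on_comp2[OF this computable_on_id N] show ?thesis .
qed

lemma computable_on_If:
  assumes "computable_on X (\<lambda>g x. of_bool (p g x))" "computable_on X A" "computable_on X B"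
  shows "computable_on X (\<lambda>g x. if p g x then A g x else B g x)"
proof -
  \<comment> \<open>The recursion has length 0 or 1: no step leaves the value of \<open>B\<close>,
    one step replaces it by that of \<open>A\<close>.\<close>
  have "computable_on X (\<lambda>g x. rec_nat (B g x) (\<lambda>_ _. A g x) (of_bool (p g x)))"
    by (rule computable_on_rec[OF assms(1,3)]) (rule computable_on_comp[OF assms(2)
      computable_on_pfst[OF computable_on_id]])
  also have "(\<lambda>g x. rec_nat (B g x) (\<lambda>_ _. A g x) (of_bool (p g x)))
    = (\<lambda>g x. if p g x then A g x else B g x)"
    by (auto simp: fun_eq_iff)
  finally show ?thesis .
qed

lemma computable_on_not:
  assumes "computable_on X (\<lambda>g x. of_bool (p g x))"
  shows "computable_on X (\<lambda>g x. of_bool (\<not> p g x))"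
proof -
  have "computable_on X (\<lambda>g x. if p g x then 0 else 1)"
    by (intro computable_on_If assms computable_on_const)
  also have "(\<lambda>g x. if p g x then 0 else 1) = (\<lambda>g x. of_bool (\<not> p g x))"
    by (auto simp: fun_eq_iff)
  finally show ?thesis .
qed

lemma computable_on_conj:
  assumes "computable_on X (\<lambda>g x. of_bool (p g x))" "computable_on X (\<lambda>g x. of_bool (q g x))"
  shows "computable_on X (\<lambda>g x. of_bool (p g x \<and> q g x))"
proof -
  have "computable_on X (\<lambda>g x. if p g x then of_bool (q g x) else 0)"
    by (intro computable_on_If assms computable_on_const)
  also have "(\<lambda>g x. if p g x then of_bool (q g x) else 0) = (\<lambda>g x. of_bool (p g x \<and> q g x))"
    by (auto simp: fun_eq_iff)
  finally show ?thesis .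
qed

lemma computable_on_disj:
  assumes "computable_on X (\<lambda>g x. of_bool (p g x))" "computable_on X (\<lambda>g x. of_bool (q g x))"
  shows "computable_on X (\<lambda>g x. of_bool (p g x \<or> q g x))"
proof -
  have "computable_on X (\<lambda>g x. if p g x then 1 else of_bool (q g x))"
    by (intro computable_on_If assms computable_on_const)
  also have "(\<lambda>g x. if p g x then 1 else of_bool (q g x)) = (\<lambda>g x. of_bool (p g x \<or> q g x))"
    by (auto simp: fun_eq_iff)
  finally show ?thesis .
qed

lemmas computable_on_basic = computable_on_id computable_on_const computable_on_Suc
  computable_on_pfst computable_on_psnd computable_on_pair computable_on_If
  computable_on_not computable_on_conj computable_on_disj

section \<open>Arithmetic and order\<close>

lemma computable_on_pred:
  assumes "computable_on X A"
  shows "computable_on X (\<lambda>g x. A g x - 1)"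
proof -
  have "computable_on X (\<lambda>g x. rec_nat 0 (\<lambda>n _. n) (A g x))"
    by (intro computable_on_rec assms computable_on_basic)
  also have "(\<lambda>g x. rec_nat 0 (\<lambda>n _. n) (A g x)) = (\<lambda>g x. A g x - 1)"
  proof (intro ext)
    show "rec_nat 0 (\<lambda>n _. n) (A g x) = A g x - 1" for g x by (cases "A g x") auto
  qed
  finally show ?thesis .
qed

lemma computable_on_diff:
  assumes "computable_on X A" "computable_on X B"
  shows "computable_on X (\<lambda>g x. A g x - B g x)"
proof -
  have "computable_on X (\<lambda>g x. rec_nat (A g x) (\<lambda>_ y. y - 1) (B g x))"
    by (intro computable_on_rec computable_on_pred assms computable_on_basic)
  also have "(\<lambda>g x. rec_nat (A g x) (\<lambda>_ y. y - 1) (B g x)) = (\<lambda>g x. A g x - B g x)"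
  proof (intro ext)
    have "rec_nat a (\<lambda>_ y. y - 1) b = a - b" for a b :: nat by (induction b) auto
    then show "rec_nat (A g x) (\<lambda>_ y. y - 1) (B g x) = A g x - B g x" for g x .
  qed
  finally show ?thesis .
qed

lemma computable_on_le:
  assumes "computable_on X A" "computable_on X B"
  shows "computable_on X (\<lambda>g x. of_bool (A g x \<le> B g x))"
proof -
  have "computable_on X (\<lambda>g x. 1 - (A g x - B g x))"
    by (intro computable_on_diff assms computable_on_const)
  also have "(\<lambda>g x. 1 - (A g x - B g x)) = (\<lambda>g x. of_bool (A g x \<le> B g x))"
    by (auto simp: fun_eq_iff)
  finally show ?thesis .
qed

lemma computable_on_less:
  assumes "computable_on X A" "computable_on X B"
  shows "computable_on X (\<lambda>g x. of_bool (A g x < B g x))"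
  using computable_on_not[OF computable_on_le[OF assms(2,1)]] by (simp add: not_le)

lemma computable_on_eq:
  fixes A B :: "(nat \<Rightarrow> nat) \<Rightarrow> nat \<Rightarrow> nat"
  assumes "computable_on X A" "computable_on X B"
  shows "computable_on X (\<lambda>g x. of_bool (A g x = B g x))"
  using computable_on_conj[OF computable_on_le[OF assms] computable_on_le[OF assms(2,1)]]
  by (simp add: eq_iff)

lemma computable_on_half: "computable_on X A \<Longrightarrow> computable_on X (\<lambda>g x. A g x div 2)"
  by (rule computable_on_comp[of X "\<lambda>g x. x div 2"])
    (unfold computable_on_def, use eval_half in blast)

lemma computable_on_even:
  assumes "computable_on X A"
  shows "computable_on X (\<lambda>g x. of_bool (even (A g x)))"
proof -
  have "computable_on X (\<lambda>g x. x mod 2)"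
    unfolding computable_on_def using eval_parity by blast
  then have "computable_on X (\<lambda>g x. of_bool (A g x mod 2 = 0))"
    by (intro computable_on_eq computable_on_const computable_on_comp[OF _ assms])
  then show ?thesis by (simp add: even_iff_mod_2_eq_zero)
qed

lemma computable_on_add:
  assumes "computable_on X A" "computable_on X B"
  shows "computable_on X (\<lambda>g x. A g x + B g x)"
proof -
  have "computable_on X (\<lambda>g x. rec_nat (A g x) (\<lambda>_ y. Suc y) (B g x))"
    by (intro computable_on_rec assms computable_on_basic)
  also have "(\<lambda>g x. rec_nat (A g x) (\<lambda>_ y. Suc y) (B g x)) = (\<lambda>g x. A g x + B g x)"
  proof (intro ext)
    have "rec_nat a (\<lambda>_ y. Suc y) b = a + b" for a b by (induction b) auto
    then show "rec_nat (A g x) (\<lambda>_ y. Suc y) (B g x) = A g x + B g x" for g x .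
  qed
  finally show ?thesis .
qed

section \<open>Unbounded search\<close>

lemma eval_Mu_Least:
  assumes c: "\<And>k. eval g c (prod_encode (x, k)) (of_bool (\<not> p k))" and ex: "\<exists>k. p k"
  shows "eval g (Mu c) x (LEAST k. p k)"
proof (rule eval.Mu)
  show "eval g c (prod_encode (x, LEAST k. p k)) 0"
    using c[of "LEAST k. p k"] LeastI_ex[OF ex] by simp
  show "\<forall>j<LEAST k. p k. \<exists>m. eval g c (prod_encode (x, j)) (Suc m)"
    using c not_less_Least[of _ p] by (metis One_nat_def of_bool_eq(2))
qed

text \<open>The search need only succeed at the stages that are actually reached, so the step function
  may be partial.\<close>

lemma computable_on_search_iterate:
  assumes p: "computable_on X (\<lambda>g z. of_bool (p g (pfst z) (psnd z)))"
    and G: "computable_on X (\<lambda>g z. G g (pfst z) (psnd z))"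
    and ex: "\<And>g n. g \<in> X \<Longrightarrow> \<exists>k. p g (s g n) k"
    and s0: "\<And>g. g \<in> X \<Longrightarrow> s g 0 = a"
    and s_Suc: "\<And>g n. g \<in> X \<Longrightarrow> s g (Suc n) = G g (s g n) (LEAST k. p g (s g n) k)"
  shows "computable_on X s"
proof -
  from computable_on_not[OF p] obtain c
    where "\<And>g z. g \<in> X \<Longrightarrow> eval g c z (of_bool (\<not> p g (pfst z) (psnd z)))"
    unfolding computable_on_def by blast
  then have c: "eval g c (prod_encode (x, k)) (of_bool (\<not> p g x k))" if "g \<in> X" for g x k
    using that by (metis fst_conv prod_encode_inverse snd_conv)
  from G obtain d where "\<And>g z. g \<in> X \<Longrightarrow> eval g d z (G g (pfst z) (psnd z))"
    unfolding computable_on_def by blast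
  then have d: "eval g d (prod_encode (x, k)) (G g x k)" if "g \<in> X" for g x k
    using that by (metis fst_conv prod_encode_inverse snd_conv)
  from computable_on_const[of UNIV a] obtain b where b: "\<And>g x. eval g b x a"
    unfolding computable_on_def by blast
  have "eval g (Iter b (Comp d (Pairing Ident (Mu c)))) n (s g n)" if g: "g \<in> X" for g n
  proof (rule eval_Iter)
    show "eval g b 0 (s g 0)" using b s0[OF g] by simp
    show "eval g (Comp d (Pairing Ident (Mu c))) (s g n) (s g (Suc n))" for n
      unfolding s_Suc[OF g]
      by (rule eval.Comp[OF eval.Pairing[OF eval_Ident eval_Mu_Least[OF c[OF g] ex[OF g]]] d[OF g]])
  qed
  then show ?thesis unfolding computable_on_def by blast
qed

lemma computable_on_Least:
  assumes p: "computable_on X (\<lambda>g z. of_bool (p g (pfst z) (psnd z)))"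
    and ex: "\<And>g x. g \<in> X \<Longrightarrow> \<exists>k. p g x k"
  shows "computable_on X (\<lambda>g x. LEAST k. p g x k)"
proof -
  from computable_on_not[OF p] obtain c
    where "\<And>g z. g \<in> X \<Longrightarrow> eval g c z (of_bool (\<not> p g (pfst z) (psnd z)))"
    unfolding computable_on_def by blast
  then have c: "eval g c (prod_encode (x, k)) (of_bool (\<not> p g x k))" if "g \<in> X" for g x k
    using that by (metis fst_conv prod_encode_inverse snd_conv)
  have "eval g (Mu c) x (LEAST k. p g x k)" if "g \<in> X" for g x
    by (rule eval_Mu_Least[OF c[OF that] ex[OF that]])
  then show ?thesis unfolding computable_on_def by blast
qed

text \<open>The code of a list bounds its length, so a primitive recursion of that length suffices.
  Stage \<open>n\<close> handles the head of the suffix left after dropping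
  \<open>N g x - Suc n\<close> entries, which reads the list from its end; stages with an empty
  suffix change nothing.\<close>

lemma computable_on_foldr:
  assumes L: "computable_on X (\<lambda>g x. list_encode (L g x))" and A: "computable_on X A"
    and H: "computable_on X (\<lambda>g z. H g (pfst z) (pfst (psnd z)) (psnd (psnd z)))"
  shows "computable_on X (\<lambda>g x. foldr (H g x) (L g x) (A g x))"
proof -
  have psnd_0: "psnd 0 = 0"
    using prod_encode_inverse[of "(0, 0)"] by (simp add: prod_encode_def)
  define tails where "tails l k = rec_nat l (\<lambda>_ y. psnd (y - 1)) k" for l k :: nat
  have tails: "tails (list_encode l) k = list_encode (drop k l)" for l k
  proof (induction k)
    case (Suc k)
    then have "tails (list_encode l) (Suc k) = psnd (list_encode (drop k l) - 1)"
      by (simp add: tails_def)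
    also have "\<dots> = list_encode (tl (drop k l))"
      by (cases "drop k l") (auto simp: psnd_0)
    finally show ?case by (simp add: tl_drop drop_Suc)
  qed (simp add: tails_def)
  have comp_tails: "computable_on X (\<lambda>g x. tails (A g x) (B g x))"
    if "computable_on X A" "computable_on X B" for A B
    unfolding tails_def
    by (intro computable_on_rec computable_on_pred computable_on_basic that)
  define N where "N = (\<lambda>g x. list_encode (L g x))"
  define B where "B g x n y = (let m = tails (N g x) (N g x - Suc n)
    in if m = 0 then y else H g x (pfst (m - 1)) y)" for g x n y
  have N: "computable_on X N" using L by (simp add: N_def)
  have H': "computable_on X (\<lambda>g x. H g (P g x) (Q g x) (R g x))"
    if "computable_on X P" "computable_on X Q" "computable_on X R" for P Q R
    using computable_on_comp[OF H computable_on_pair[OF that(1) computable_on_pair[OF that(2,3)]]]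
    by simp
  have "computable_on X (\<lambda>g x. rec_nat (A g x) (B g x) (N g x))"
    unfolding B_def Let_def
    by (intro computable_on_rec computable_on_eq comp_tails computable_on_diff computable_on_pred
        computable_on_basic H' A N computable_on_comp[OF N])
  moreover have "rec_nat (A g x) (B g x) (N g x) = foldr (H g x) (L g x) (A g x)" for g x
  proof -
    have len: "length l \<le> list_encode l" for l
    proof (induction l)
      case (Cons b l)
      then show ?case using le_prod_encode_2[of "list_encode l" b] by simp
    qed simp
    have "rec_nat (A g x) (B g x) n = foldr (H g x) (drop (N g x - n) (L g x)) (A g x)"
      if "n \<le> N g x" for n
      using that
    proof (induction n)
      case 0
      then show ?case using len[of "L g x"] by (simp add: N_def)
    next
      case (Suc n)
      let ?m = "drop (N g x - Suc n) (L g x)"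
      have tl: "drop (N g x - n) (L g x) = tl ?m"
        using Suc.prems by (metis Suc_diff_Suc Suc_le_eq drop_Suc tl_drop)
      have "rec_nat (A g x) (B g x) (Suc n) = B g x n (foldr (H g x) (tl ?m) (A g x))"
        using Suc tl by simp
      also have "\<dots> = foldr (H g x) ?m (A g x)"
        unfolding B_def Let_def N_def tails by (cases "drop (list_encode (L g x) - Suc n) (L g x)") auto
      finally show ?case .
    qed
    from this[of "N g x"] show ?thesis by simp
  qed
  ultimately show ?thesis by simp
qed

subsection \<open>Bounded evaluation with a partial oracle\<close>

fun enc_opt :: "nat option \<Rightarrow> nat" where
  "enc_opt None = 0"
| "enc_opt (Some y) = Suc y"

lemma computable_on_Some: "computable_on X A \<Longrightarrow> computable_on X (\<lambda>g x. enc_opt (Some (A g x)))"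
  by (simp add: computable_on_Suc)

lemma computable_on_None: "computable_on X (\<lambda>g x. enc_opt None)"
  by (simp add: computable_on_const)

lemma computable_on_If_opt:
  assumes "computable_on X (\<lambda>g x. of_bool (p g x))"
    "computable_on X (\<lambda>g x. enc_opt (A g x))" "computable_on X (\<lambda>g x. enc_opt (B g x))"
  shows "computable_on X (\<lambda>g x. enc_opt (if p g x then A g x else B g x))"
  using computable_on_If[OF assms] by (simp add: if_distrib)

lemma computable_on_bind:
  assumes R: "computable_on X (\<lambda>g x. enc_opt (R g x))"
    and F: "computable_on X (\<lambda>g z. enc_opt (F g (pfst z) (psnd z)))"
  shows "computable_on X (\<lambda>g x. enc_opt (Option.bind (R g x) (F g x)))"
proof -
  have "computable_on X (\<lambda>g x. if enc_opt (R g x) = 0 then 0 else enc_opt (F g x (enc_opt (R g x) - 1)))"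
    by (intro computable_on_comp2[OF F] computable_on_eq computable_on_pred computable_on_basic R)
  also have "(\<lambda>g x. if enc_opt (R g x) = 0 then 0 else enc_opt (F g x (enc_opt (R g x) - 1)))
    = (\<lambda>g x. enc_opt (Option.bind (R g x) (F g x)))"
  proof (intro ext)
    show "(if enc_opt (R g x) = 0 then 0 else enc_opt (F g x (enc_opt (R g x) - 1)))
      = enc_opt (Option.bind (R g x) (F g x))" for g x by (cases "R g x") auto
  qed
  finally show ?thesis .
qed

text \<open>Evaluation with a partial oracle: unbounded searches are cut off at \<open>s\<close>, and \<open>None\<close> means
  that the oracle or the bound did not suffice.\<close>

primrec sim :: "nat \<Rightarrow> (nat \<Rightarrow> nat option) \<Rightarrow> code \<Rightarrow> nat \<Rightarrow> nat option" where
  "sim s \<phi> Zero x = Some 0"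
| "sim s \<phi> Succ x = Some (Suc x)"
| "sim s \<phi> Fst x = Some (pfst x)"
| "sim s \<phi> Snd x = Some (psnd x)"
| "sim s \<phi> Oracle x = \<phi> x"
| "sim s \<phi> (Pairing c d) x =
    Option.bind (sim s \<phi> c x) (\<lambda>y. Option.bind (sim s \<phi> d x) (\<lambda>z. Some (prod_encode (y, z))))"
| "sim s \<phi> (Comp c d) x = Option.bind (sim s \<phi> d x) (sim s \<phi> c)"
| "sim s \<phi> (Prec c d) x = rec_nat (sim s \<phi> c (pfst x))
    (\<lambda>n r. Option.bind r (\<lambda>y. sim s \<phi> d (prod_encode (pfst x, prod_encode (n, y))))) (psnd x)"
| "sim s \<phi> (Mu c) x =
    (let k = (LEAST k. s \<le> k \<or> enc_opt (sim s \<phi> c (prod_encode (x, k))) \<le> 1)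
     in if k < s \<and> enc_opt (sim s \<phi> c (prod_encode (x, k))) = 1 then Some k else None)"

text \<open>The cut-off search also stops at the first undefined value:
  \<open>enc_opt r \<le> 1\<close> covers \<open>None\<close> and \<open>Some 0\<close>. The
  equivalence brings the result into the shape of the rule \<open>eval.Mu\<close>.\<close>

lemma sim_Mu_eq_Some_iff:
  "sim s \<phi> (Mu c) x = Some k \<longleftrightarrow> k < s \<and> sim s \<phi> c (prod_encode (x, k)) = Some 0 \<and>
    (\<forall>j<k. \<exists>m. sim s \<phi> c (prod_encode (x, j)) = Some (Suc m))"
proof -
  let ?p = "\<lambda>k. s \<le> k \<or> enc_opt (sim s \<phi> c (prod_encode (x, k))) \<le> 1"
  have 1: "enc_opt r = 1 \<longleftrightarrow> r = Some 0" for r by (cases r) auto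
  have 2: "\<not> enc_opt r \<le> 1 \<longleftrightarrow> (\<exists>m. r = Some (Suc m))" for r
    by (cases r) (auto simp: not_le less_Suc_eq_0_disj gr0_conv_Suc)
  show ?thesis
  proof
    assume "sim s \<phi> (Mu c) x = Some k"
    then have k: "k = (LEAST k. ?p k)" "k < s" "enc_opt (sim s \<phi> c (prod_encode (x, k))) = 1"
      by (auto simp: Let_def split: if_splits)
    then show "k < s \<and> sim s \<phi> c (prod_encode (x, k)) = Some 0 \<and>
      (\<forall>j<k. \<exists>m. sim s \<phi> c (prod_encode (x, j)) = Some (Suc m))"
      unfolding 1 using not_less_Least[of _ ?p] 2 by (metis (no_types, lifting))
  next
    assume k: "k < s \<and> sim s \<phi> c (prod_encode (x, k)) = Some 0 \<and>
      (\<forall>j<k. \<exists>m. sim s \<phi> c (prod_encode (x, j)) = Some (Suc m))"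
    have "(LEAST k. ?p k) = k"
    proof (rule Least_equality)
      show "?p k" using k by simp
      show "k \<le> j" if "?p j" for j
      proof (rule ccontr)
        assume "\<not> k \<le> j"
        with k that 2 show False by (metis le_less_trans less_imp_le not_le)
      qed
    qed
    with k show "sim s \<phi> (Mu c) x = Some k" by simp
  qed
qed

lemma sim_mono:
  assumes "\<phi> \<subseteq>\<^sub>m \<psi>" "s \<le> t"
  shows "sim s \<phi> e x = Some y \<Longrightarrow> sim t \<psi> e x = Some y"
proof (induction e arbitrary: x y)
  case Oracle
  then show ?case using assms(1) by (auto simp: map_le_def dom_def)
next
  case (Prec c d)
  have "sim t \<psi> (Prec c d) (prod_encode (a, n)) = Some y"
    if "sim s \<phi> (Prec c d) (prod_encode (a, n)) = Some y" for a n y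
    using that by (induction n arbitrary: y) (auto simp: bind_eq_Some_conv dest: Prec.IH)
  from this[of "pfst x" "psnd x" y] Prec.prems show ?case by simp
next
  case (Mu c)
  then show ?case unfolding sim_Mu_eq_Some_iff using assms(2) by (meson less_le_trans)
qed (auto simp: bind_eq_Some_conv; blast)+

lemma sim_sound:
  assumes "\<phi> \<subseteq>\<^sub>m Some \<circ> g"
  shows "sim s \<phi> e x = Some y \<Longrightarrow> eval g e x y"
proof (induction e arbitrary: x y)
  case Oracle
  then have "g x = y" using assms by (auto simp: map_le_def dom_def)
  then show ?case using eval.Oracle by blast
next
  case (Prec c d)
  have "eval g (Prec c d) (prod_encode (a, n)) y"
    if "sim s \<phi> (Prec c d) (prod_encode (a, n)) = Some y" for a n y
    using that by (induction n arbitrary: y)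
      (auto simp: bind_eq_Some_conv intro: eval.intros Prec.IH)
  from this[of "pfst x" "psnd x" y] Prec.prems show ?case by simp
next
  case (Mu c)
  then show ?case unfolding sim_Mu_eq_Some_iff by (meson eval.Mu)
qed (auto simp: bind_eq_Some_conv intro: eval.intros, blast intro: eval.Comp)

text \<open>The use principle: a halting computation makes finitely many oracle queries and search
  steps, so one \<open>N\<close> bounds both.\<close>

lemma sim_complete:
  assumes "eval g e x y"
  shows "\<exists>N. \<forall>s \<phi>. N \<le> s \<longrightarrow> (\<forall>i<N. \<phi> i = Some (g i)) \<longrightarrow> sim s \<phi> e x = Some y"
  using assms
proof induction
  case (Oracle x)
  then show ?case by (intro exI[of _ "Suc x"]) auto
next
  case (Pairing c x y d z)
  then obtain N M where "\<And>s \<phi>. N \<le> s \<Longrightarrow> \<forall>i<N. \<phi> i = Some (g i) \<Longrightarrow> sim s \<phi> c x = Some y"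
    "\<And>s \<phi>. M \<le> s \<Longrightarrow> \<forall>i<M. \<phi> i = Some (g i) \<Longrightarrow> sim s \<phi> d x = Some z" by blast
  then show ?case by (intro exI[of _ "max N M"]) auto
next
  case (Comp d x y c z)
  then obtain N M where "\<And>s \<phi>. N \<le> s \<Longrightarrow> \<forall>i<N. \<phi> i = Some (g i) \<Longrightarrow> sim s \<phi> d x = Some y"
    "\<And>s \<phi>. M \<le> s \<Longrightarrow> \<forall>i<M. \<phi> i = Some (g i) \<Longrightarrow> sim s \<phi> c y = Some z" by blast
  then show ?case by (intro exI[of _ "max N M"]) auto
next
  case (Prec_Suc c d a n y z)
  then obtain N M where
    "\<And>s \<phi>. N \<le> s \<Longrightarrow> \<forall>i<N. \<phi> i = Some (g i) \<Longrightarrow> sim s \<phi> (Prec c d) (prod_encode (a, n)) = Some y"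
    "\<And>s \<phi>. M \<le> s \<Longrightarrow> \<forall>i<M. \<phi> i = Some (g i) \<Longrightarrow>
      sim s \<phi> d (prod_encode (a, prod_encode (n, y))) = Some z" by blast
  then show ?case by (intro exI[of _ "max N M"]) auto
next
  case (Mu c a k)
  from Mu.IH(2) obtain m where
    "\<forall>j<k. \<exists>N. \<forall>s \<phi>. N \<le> s \<longrightarrow> (\<forall>i<N. \<phi> i = Some (g i)) \<longrightarrow>
      sim s \<phi> c (prod_encode (a, j)) = Some (Suc (m j))" by metis
  then obtain N where N: "\<And>j s \<phi>. j < k \<Longrightarrow> N j \<le> s \<Longrightarrow> \<forall>i<N j. \<phi> i = Some (g i) \<Longrightarrow>
      sim s \<phi> c (prod_encode (a, j)) = Some (Suc (m j))" by metis
  from Mu.IH(1) obtain M where M: "\<And>s \<phi>. M \<le> s \<Longrightarrow> \<forall>i<M. \<phi> i = Some (g i) \<Longrightarrow>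
      sim s \<phi> c (prod_encode (a, k)) = Some 0" by blast
  \<comment> \<open>The sum dominates the bounds of the finitely many failed candidates;
    \<open>Suc\<close> and \<open>k\<close> push the cut-off beyond the result
    \<open>k\<close>.\<close>
  define B where "B = Suc (k + M + sum N {..<k})"
  have B: "N j \<le> B" if "j < k" for j
    using member_le_sum[of j "{..<k}" N] that by (simp add: B_def)
  show ?case
  proof (intro exI[of _ B] allI impI)
    fix s \<phi> assume s: "B \<le> s" "\<forall>i<B. \<phi> i = Some (g i)"
    show "sim s \<phi> (Mu c) a = Some k"
      unfolding sim_Mu_eq_Some_iff
    proof (intro conjI allI impI)
      show "k < s" using s by (simp add: B_def)
      show "sim s \<phi> c (prod_encode (a, k)) = Some 0"
        using s by (intro M) (auto simp: B_def)
      show "\<exists>m. sim s \<phi> c (prod_encode (a, j)) = Some (Suc m)" if "j < k" for j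
        using N[OF that, of s \<phi>] B[OF that] s by (meson less_le_trans order_trans)
    qed
  qed
qed auto

text \<open>Induction on the fixed program \<open>e\<close> avoids a universal program. The first
  component of \<open>z\<close> selects the bound and the oracle and stays fixed while subprograms
  change the input in the second.\<close>

lemma computable_on_sim_aux:
  assumes S: "computable_on X S"
    and \<phi>: "computable_on X (\<lambda>g z. enc_opt (\<phi> g (pfst z) (psnd z)))"
  shows "computable_on X (\<lambda>g z. enc_opt (sim (S g (pfst z)) (\<phi> g (pfst z)) e (psnd z)))"
proof (induction e)
  case (Pairing c d)
  show ?case unfolding sim.simps
    by (intro computable_on_bind computable_on_Some computable_on_basic computable_on_comp2[OF Pairing(1)]
      computable_on_comp2[OF Pairing(2)])
next
  case (Comp c d)
  show ?case unfolding sim.simps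
    by (intro computable_on_bind computable_on_basic computable_on_comp2[OF Comp(1)]
      computable_on_comp2[OF Comp(2)])
next
  case (Prec c d)
  define B where "B g z n r = (if r = 0 then 0 else enc_opt (sim (S g (pfst z)) (\<phi> g (pfst z)) d
      (prod_encode (pfst (psnd z), prod_encode (n, r - 1)))))" for g z n r
  have "computable_on X (\<lambda>g z. rec_nat
      (enc_opt (sim (S g (pfst z)) (\<phi> g (pfst z)) c (pfst (psnd z)))) (B g z) (psnd (psnd z)))"
    unfolding B_def
    by (intro computable_on_rec computable_on_eq computable_on_pred computable_on_basic
      computable_on_comp2[OF Prec(1)] computable_on_comp2[OF Prec(2)])
  moreover have "rec_nat (enc_opt (sim (S g (pfst z)) (\<phi> g (pfst z)) c a)) (B g z) n
    = enc_opt (rec_nat (sim (S g (pfst z)) (\<phi> g (pfst z)) c a)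
      (\<lambda>n r. Option.bind r (\<lambda>y. sim (S g (pfst z)) (\<phi> g (pfst z)) d
        (prod_encode (pfst (psnd z), prod_encode (n, y))))) n)" for g z n a
  proof (induction n)
    case (Suc n)
    let ?r = "rec_nat (sim (S g (pfst z)) (\<phi> g (pfst z)) c a)
      (\<lambda>n r. Option.bind r (\<lambda>y. sim (S g (pfst z)) (\<phi> g (pfst z)) d
        (prod_encode (pfst (psnd z), prod_encode (n, y))))) n"
    show ?case using Suc by (cases ?r) (simp_all add: B_def)
  qed simp
  ultimately show ?case by simp
next
  case (Mu c)
  \<comment> \<open>The search is total because the bound itself meets the stopping
    condition.\<close>
  show ?case unfolding sim.simps Let_def
    by (rule computable_on_If_opt computable_on_Some computable_on_None computable_on_Least
      computable_on_less computable_on_le computable_on_eq computable_on_basic computable_on_comp2[OF Mu]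
      computable_on_comp[OF S] exI disjI1 le_refl)+
qed (simp_all, (intro \<phi> computable_on_basic)+)

lemma computable_on_sim:
  assumes "computable_on X S" "computable_on X (\<lambda>g z. enc_opt (\<phi> g (pfst z) (psnd z)))" "computable_on X A"
  shows "computable_on X (\<lambda>g x. enc_opt (sim (S g x) (\<phi> g x) e (A g x)))"
  by (rule computable_on_comp2[OF computable_on_sim_aux[OF assms(1,2)] computable_on_id assms(3)])

subsection \<open>Strings and trees\<close>

lemma computable_on_Cons:
  "computable_on X A \<Longrightarrow> computable_on X (\<lambda>g x. list_encode (L g x)) \<Longrightarrow>
    computable_on X (\<lambda>g x. list_encode (A g x # L g x))"
  by (simp add: computable_on_Suc computable_on_pair)

lemma computable_on_list_decode:
  "computable_on X A \<Longrightarrow> computable_on X (\<lambda>g x. list_encode (list_decode (A g x)))"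
  by simp

lemma computable_on_append:
  assumes "computable_on X (\<lambda>g x. list_encode (K g x))" "computable_on X (\<lambda>g x. list_encode (L g x))"
  shows "computable_on X (\<lambda>g x. list_encode (K g x @ L g x))"
proof -
  have "computable_on X (\<lambda>g x. foldr (\<lambda>b acc. Suc (prod_encode (b, acc))) (K g x) (list_encode (L g x)))"
    by (intro computable_on_foldr computable_on_basic assms)
  moreover have "foldr (\<lambda>b acc. Suc (prod_encode (b, acc))) k (list_encode l) = list_encode (k @ l)" for k l
    by (induction k) auto
  ultimately show ?thesis by simp
qed

lemma computable_on_length:
  assumes "computable_on X (\<lambda>g x. list_encode (L g x))"
  shows "computable_on X (\<lambda>g x. length (L g x))"
proof -
  have "computable_on X (\<lambda>g x. foldr (\<lambda>_. Suc) (L g x) 0)"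
    by (intro computable_on_foldr computable_on_basic assms)
  moreover have "foldr (\<lambda>_. Suc) l 0 = length l" for l :: "nat list"
    by (induction l) auto
  ultimately show ?thesis by simp
qed

text \<open>A total search for the least counterexample, with \<open>N g x\<close> as fallback: the
  quantifier holds iff the search does not stop earlier.\<close>

lemma computable_on_bounded_all:
  assumes N: "computable_on X N" and p: "computable_on X (\<lambda>g z. of_bool (p g (pfst z) (psnd z)))"
  shows "computable_on X (\<lambda>g x. of_bool (\<forall>n<N g x. p g x n))"
proof -
  have "computable_on X (\<lambda>g x. of_bool (N g x \<le> (LEAST k. N g x \<le> k \<or> \<not> p g x k)))"
    by (intro computable_on_le N computable_on_Least computable_on_disj computable_on_not p
      computable_on_basic computable_on_comp[OF N]) auto
  moreover have "N g x \<le> (LEAST k. N g x \<le> k \<or> \<not> p g x k) \<longleftrightarrow> (\<forall>n<N g x. p g x n)" for g x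
  proof
    assume "N g x \<le> (LEAST k. N g x \<le> k \<or> \<not> p g x k)"
    then show "\<forall>n<N g x. p g x n"
      using not_less_Least[of _ "\<lambda>k. N g x \<le> k \<or> \<not> p g x k"] by (meson less_le_trans)
  next
    assume "\<forall>n<N g x. p g x n"
    then show "N g x \<le> (LEAST k. N g x \<le> k \<or> \<not> p g x k)"
      using LeastI[of "\<lambda>k. N g x \<le> k \<or> \<not> p g x k" "N g x"] by (metis le_refl linorder_not_less)
  qed
  ultimately show ?thesis by simp
qed

text \<open>Finite strings are lists with the \<^emph>\<open>newest\<close> entry first: \<open>seg f n\<close> is
  \<open>[f (n - 1), \<dots>, f 0]\<close>, and \<open>u @ w\<close> extends \<open>w\<close> by \<open>u\<close>.\<close>

primrec seg :: "(nat \<Rightarrow> nat) \<Rightarrow> nat \<Rightarrow> nat list" where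
  "seg f 0 = []"
| "seg f (Suc n) = f n # seg f n"

text \<open>The string as a partial oracle for \<open>sim\<close>; \<open>rev\<close> because
  positions count from the oldest entry.\<close>

definition look :: "nat list \<Rightarrow> nat \<Rightarrow> nat option" where
  "look l i = (if i < length l then Some (rev l ! i) else None)"

definition cat :: "nat list \<Rightarrow> (nat \<Rightarrow> nat) \<Rightarrow> nat \<Rightarrow> nat" where
  "cat w p i = (if i < length w then rev w ! i else p (i - length w))"

lemma rev_seg: "rev (seg f n) = map f [0..<n]"
  by (induction n) auto

lemma length_seg [simp]: "length (seg f n) = n"
  by (induction n) auto

lemma seg_cong: "(\<And>i. i < n \<Longrightarrow> f i = g i) \<Longrightarrow> seg f n = seg g n"
  by (induction n) auto

lemma set_seg: "set (seg f n) = f ` {..<n}"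
  by (induction n) (auto simp: lessThan_Suc)

lemma seg_add: "seg f (n + k) = seg (\<lambda>i. f (n + i)) k @ seg f n"
  by (induction k) auto

lemma seg_le: "n \<le> m \<Longrightarrow> \<exists>u. seg f m = u @ seg f n"
  using seg_add[of f n "m - n"] by auto

lemma look_seg: "look (seg f n) i = (if i < n then Some (f i) else None)"
  by (simp add: look_def rev_seg)

lemma look_append: "look w \<subseteq>\<^sub>m look (u @ w)"
  by (auto simp: map_le_def look_def nth_append dom_def)

lemma look_cat: "look w \<subseteq>\<^sub>m Some \<circ> cat w p"
  by (auto simp: map_le_def look_def cat_def dom_def)

lemma seg_cat: "seg (cat w p) (length w + k) = seg p k @ w"
proof -
  have "rev (seg (cat w p) (length w)) = rev w"
    unfolding rev_seg by (rule nth_equalityI) (auto simp: cat_def)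
  then have "seg (cat w p) (length w) = w" by simp
  then show ?thesis unfolding seg_add by (simp add: cat_def)
qed

lemma suffix_seg:
  assumes "\<And>i. i < m \<Longrightarrow> look l i = Some (f i)"
  shows "\<exists>u. l = u @ seg f m"
proof -
  have m: "m \<le> length l"
    using assms by (metis linorder_not_le look_def option.distinct(1) order_less_irrefl)
  have "take m (rev l) = map f [0..<m]"
    by (rule nth_equalityI) (use m assms in \<open>auto simp: look_def split: if_splits\<close>)
  then have "rev l = rev (seg f m) @ drop m (rev l)"
    unfolding rev_seg by (metis append_take_drop_id)
  then have "l = rev (drop m (rev l)) @ seg f m"
    by (metis rev_append rev_rev_ident)
  then show ?thesis by blast
qed

lemma computable_on_seg:
  assumes "computable_on X F" "computable_on X N"
  shows "computable_on X (\<lambda>g x. list_encode (seg (F g) (N g x)))"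
proof -
  have "computable_on X (\<lambda>g x. rec_nat 0 (\<lambda>n y. Suc (prod_encode (F g n, y))) (N g x))"
    by (intro computable_on_rec computable_on_basic computable_on_comp[OF assms(1)] assms)
  moreover have "rec_nat 0 (\<lambda>n y. Suc (prod_encode (f n, y))) n = list_encode (seg f n)" for f n
    by (induction n) auto
  ultimately show ?thesis by simp
qed

lemma computable_on_look:
  assumes L: "computable_on X (\<lambda>g x. list_encode (L g x))" and I: "computable_on X I"
  shows "computable_on X (\<lambda>g x. enc_opt (look (L g x) (I g x)))"
proof -
  \<comment> \<open>\<open>foldr\<close> meets the oldest entry first: the first component counts
    positions, the second holds the coded answer, 0 until position \<open>i\<close> is
    reached.\<close>
  define H where "H i b y = prod_encode (Suc (pfst y), if pfst y = i then Suc b else psnd y)" for i b y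
  have "computable_on X (\<lambda>g x. psnd (foldr (H (I g x)) (L g x) (prod_encode (0, 0))))"
    unfolding H_def
    by (intro computable_on_psnd computable_on_foldr computable_on_eq computable_on_basic L
      computable_on_comp[OF I])
  moreover have "foldr (H i) l (prod_encode (0, 0)) = prod_encode (length l, enc_opt (look l i))" for i l
    by (induction l) (auto simp: H_def look_def nth_append)
  ultimately show ?thesis by simp
qed

lemma computable_on_binary:
  assumes L: "computable_on X (\<lambda>g x. list_encode (L g x))"
  shows "computable_on X (\<lambda>g x. of_bool (\<forall>b\<in>set (L g x). b \<le> 1))"
proof -
  have "computable_on X (\<lambda>g x. foldr (\<lambda>b y. if b \<le> 1 then y else 0) (L g x) 1)"
    by (intro computable_on_foldr computable_on_le computable_on_basic L)
  moreover have "foldr (\<lambda>b y. if b \<le> 1 then y else 0) l 1 = (of_bool (\<forall>b\<in>set l. b \<le> 1) :: nat)"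
    for l :: "nat list"
    by (induction l) auto
  ultimately show ?thesis by (simp only:)
qed

text \<open>A string is discarded once \<open>e\<close> is seen to output 0, with inputs, search
  bound and oracle all limited by the length of the string. This makes the tree decidable.\<close>

definition pi01_tree :: "code \<Rightarrow> nat list \<Rightarrow> bool" where
  "pi01_tree e l \<longleftrightarrow> (\<forall>b\<in>set l. b \<le> 1) \<and> (\<forall>n<length l. sim (length l) (look l) e n \<noteq> Some 0)"

lemma pi01_tree_append:
  assumes "pi01_tree e (u @ w)"
  shows "pi01_tree e w"
proof -
  have "sim (length w) (look w) e n \<noteq> Some 0" if "n < length w" for n
  proof -
    have "sim (length (u @ w)) (look (u @ w)) e n \<noteq> Some 0"
      using assms that by (simp add: pi01_tree_def)
    then show ?thesis
      using sim_mono[OF look_append, of "length w" "length (u @ w)" w e n 0 u] by auto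
  qed
  with assms show ?thesis by (simp add: pi01_tree_def)
qed

lemma computable_on_pi01_tree:
  assumes L: "computable_on X (\<lambda>g x. list_encode (L g x))"
  shows "computable_on X (\<lambda>g x. of_bool (pi01_tree e (L g x)))"
proof -
  have *: "sim s \<phi> e n \<noteq> Some 0 \<longleftrightarrow> \<not> enc_opt (sim s \<phi> e n) = 1" for s \<phi> n
    by (cases "sim s \<phi> e n") auto
  show ?thesis
    unfolding pi01_tree_def *
    by (intro computable_on_conj computable_on_binary L computable_on_bounded_all computable_on_length
      computable_on_not computable_on_eq computable_on_sim computable_on_look computable_on_basic
      computable_on_comp[OF L])
qed

text \<open>A failure of \<open>R f n\<close> shows on a finite initial segment by
  \<open>sim_complete\<close>; \<open>sim_sound\<close> protects the initial segments of true
  members.\<close>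

lemma pi01_tree_seg_iff:
  assumes "\<And>f n. eval f e n (of_bool (R f n))"
  shows "(\<forall>n. pi01_tree e (seg f n)) \<longleftrightarrow> f \<in> cantor_space \<and> (\<forall>n. R f n)"
proof
  assume T: "\<forall>n. pi01_tree e (seg f n)"
  have "f n \<in> {0, 1}" for n
    using T[rule_format, of "Suc n"] by (auto simp: pi01_tree_def)
  moreover have "R f n" for n
  proof (rule ccontr)
    assume "\<not> R f n"
    then have "eval f e n 0" using assms[of f n] by simp
    then obtain N where "\<And>s \<phi>. N \<le> s \<Longrightarrow> \<forall>i<N. \<phi> i = Some (f i) \<Longrightarrow> sim s \<phi> e n = Some 0"
      using sim_complete by blast
    \<comment> \<open>\<open>N\<close> covers the use of the computation; \<open>Suc n\<close>
      ensures that input \<open>n\<close> is tested.\<close>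
    then have "sim (max N (Suc n)) (look (seg f (max N (Suc n)))) e n = Some 0"
      by (rule) (auto simp: look_seg)
    moreover have "n < max N (Suc n)" by simp
    ultimately show False using T unfolding pi01_tree_def by (metis length_seg)
  qed
  ultimately show "f \<in> cantor_space \<and> (\<forall>n. R f n)" by (simp add: cantor_space_def)
next
  assume f: "f \<in> cantor_space \<and> (\<forall>n. R f n)"
  have "sim n (look (seg f n)) e i \<noteq> Some 0" for i n
  proof
    assume "sim n (look (seg f n)) e i = Some 0"
    moreover have "look (seg f n) \<subseteq>\<^sub>m Some \<circ> f" by (auto simp: map_le_def look_seg dom_def)
    ultimately have "eval f e i 0" by (rule sim_sound[rotated])
    with assms[of f i] f show False by (auto dest: eval_deterministic)
  qed
  moreover have "f i \<le> 1" for i using f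
    by (auto simp: cantor_space_def dest: spec[of _ i])
  ultimately show "\<forall>n. pi01_tree e (seg f n)" by (auto simp: pi01_tree_def set_seg)
qed

subsection \<open>Iterated concatenation\<close>

locale decidable_tree =
  fixes T :: "nat list \<Rightarrow> bool" and P :: "(nat \<Rightarrow> nat) set"
  assumes T_append: "T (u @ w) \<Longrightarrow> T w"
    and T_binary: "T l \<Longrightarrow> b \<in> set l \<Longrightarrow> b \<le> 1"
    and computable_on_T: "computable_on X (\<lambda>g x. list_encode (L g x)) \<Longrightarrow>
      computable_on X (\<lambda>g x. of_bool (T (L g x)))"
    and P_iff: "f \<in> P \<longleftrightarrow> (\<forall>n. T (seg f n))"
    and P_nonempty: "P \<noteq> {}"
    and P_special: "f \<in> P \<Longrightarrow> \<not> computable f"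
begin

lemma T_seg: "f \<in> P \<Longrightarrow> T (seg f n)"
  by (simp add: P_iff)

lemma T_Nil: "T []"
  using P_nonempty T_seg[of _ 0] by auto

text \<open>\<open>run l\<close> consists of the position in the current copy of \<open>T\<close> and the string of recorded bits.  The
  minimal strings outside \<open>T\<close> serve as terminators of a copy.\<close>

primrec run :: "nat list \<Rightarrow> nat list \<times> nat list" where
  "run [] = ([], [])"
| "run (b # l) = (if T (fst (run l)) then (b # fst (run l), snd (run l)) else ([], b # snd (run l)))"

definition Q :: "(nat \<Rightarrow> nat) set" where
  "Q = {f \<in> cantor_space. \<forall>n. T (snd (run (seg f n)))}"

lemma snd_run_append: "\<exists>v. snd (run (u @ w)) = v @ snd (run w)"
  by (induction u) auto

text \<open>The hypothesis concerns \<open>tl u\<close>, the string without its newest bit: the bit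
  that leaves \<open>T\<close> still belongs to the copy, and only the bit after it is
  recorded.\<close>

lemma run_append:
  assumes "run w = ([], t)" "T (tl u)"
  shows "run (u @ w) = (u, t)"
  using assms(2)
proof (induction u)
  case (Cons b u)
  have "T (tl u)" using T_append[of "[hd u]" "tl u"] T_Nil Cons.prems by (cases u) auto
  with Cons show ?case by simp
qed (simp add: assms)

lemma run_append_seg: "run w = ([], t) \<Longrightarrow> p \<in> P \<Longrightarrow> run (seg p n @ w) = (seg p n, t)"
  by (rule run_append) (cases n; auto simp: T_Nil T_seg)+

lemma P_binary: "f \<in> P \<Longrightarrow> f i \<le> 1"
  using T_seg[of f "Suc i"] T_binary by simp

text \<open>After \<open>w\<close> a fresh copy begins, and a path of \<open>T\<close> never leaves
  it, so the recorded string stays \<open>t\<close>. Earlier recorded strings are initial segments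
  of \<open>t\<close>.\<close>

lemma cat_mem_Q:
  assumes w: "run w = ([], t)" "\<forall>b\<in>set w. b \<le> 1" and t: "T t" and p: "p \<in> P"
  shows "cat w p \<in> Q"
proof -
  have "cat w p i \<in> {0, 1}" for i
  proof -
    have "cat w p i \<le> 1"
      using w(2) P_binary[OF p] nth_mem[of i "rev w"] by (auto simp: cat_def)
    then show ?thesis by (auto simp: le_Suc_eq)
  qed
  moreover have "T (snd (run (seg (cat w p) n)))" for n
  proof -
    obtain u where "seg (cat w p) (length w + n) = u @ seg (cat w p) n"
      using seg_le[of n "length w + n"] by auto
    moreover have "snd (run (seg (cat w p) (length w + n))) = t"
      unfolding seg_cat using run_append_seg[OF w(1) p] by simp
    ultimately show ?thesis using snd_run_append[of u "seg (cat w p) n"] t T_append by metis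
  qed
  ultimately show ?thesis by (simp add: Q_def cantor_space_def)
qed

lemma Q_nonempty: "Q \<noteq> {}"
  using cat_mem_Q[of "[]" "[]"] P_nonempty T_Nil by auto

lemma computable_on_run:
  assumes L: "computable_on X (\<lambda>g x. list_encode (L g x))"
  shows "computable_on X (\<lambda>g x. list_encode (fst (run (L g x))))"
    and "computable_on X (\<lambda>g x. list_encode (snd (run (L g x))))"
proof -
  define H where "H b z = (if T (list_decode (pfst z))
    then prod_encode (Suc (prod_encode (b, pfst z)), psnd z)
    else prod_encode (0, Suc (prod_encode (b, psnd z))))" for b z
  have H: "foldr H l (prod_encode (0, 0)) = prod_encode (list_encode (fst (run l)), list_encode (snd (run l)))"
    for l
    by (induction l) (auto simp: H_def)
  have "computable_on X (\<lambda>g x. foldr H (L g x) (prod_encode (0, 0)))"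
    unfolding H_def
    by (intro computable_on_foldr computable_on_T computable_on_list_decode computable_on_basic L)
  from computable_on_pfst[OF this] computable_on_psnd[OF this]
  show "computable_on X (\<lambda>g x. list_encode (fst (run (L g x))))"
    and "computable_on X (\<lambda>g x. list_encode (snd (run (L g x))))"
    by (simp_all add: H)
qed

section \<open>\<open>Q\<close> as an effectively closed class without computable elements\<close>

lemma pi01_Q: "pi01 Q"
proof -
  define R where "R f n \<longleftrightarrow> (\<forall>b\<in>set (seg f n). b \<le> 1) \<and> T (snd (run (seg f n)))" for f n
  have "computable_on UNIV (\<lambda>g n. of_bool (R g n))"
    unfolding R_def
    by (intro computable_on_conj computable_on_binary computable_on_T computable_on_run
      computable_on_seg computable_on_oracle computable_on_basic)
  then have "computable_relation R"
    unfolding computable_on_def computable_relation_def by blast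
  moreover have "Q = {f. \<forall>n. R f n}"
    by (auto simp: Q_def R_def cantor_space_def set_seg le_Suc_eq)
  ultimately show ?thesis unfolding pi01_def by blast
qed

lemma computable_on_computable:
  assumes "computable_on {g} F" "computable g"
  shows "computable (F g)"
  using assms unfolding computable_on_def computable_def by (blast intro: eval_subst_oracle)

text \<open>Here \<open>k\<close> is the stage at which the current copy began; it either persists
  or is reset to \<open>Suc n\<close> with an empty position.\<close>

lemma fst_run_seg: "\<exists>k\<le>n. fst (run (seg g n)) = seg (\<lambda>i. g (k + i)) (n - k)"
proof (induction n)
  case (Suc n)
  then obtain k where "k \<le> n" "fst (run (seg g n)) = seg (\<lambda>i. g (k + i)) (n - k)" by blast
  then have "fst (run (seg g (Suc n))) \<in> {seg (\<lambda>i. g (k + i)) (Suc n - k),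
      seg (\<lambda>i. g (Suc n + i)) (Suc n - Suc n)}"
    by (auto simp: Suc_diff_le)
  with \<open>k \<le> n\<close> show ?case by (auto intro: exI[of _ k] exI[of _ "Suc n"])
qed simp

lemma Q_special:
  assumes g: "g \<in> Q"
  shows "\<not> computable g"
proof
  assume comp: "computable g"
  have T: "T (snd (run (seg g n)))" for n using g by (simp add: Q_def)
  show False
  \<comment> \<open>Either the copy in use at stage \<open>N\<close> is never left again, or
    infinitely many bits are recorded.\<close>
  proof (cases "\<exists>N. \<forall>n\<ge>N. T (fst (run (seg g n)))")
    case True
    then obtain N where "\<forall>n\<ge>N. T (fst (run (seg g n)))" by blast
    then have N: "T (fst (run (seg g (N + n))))" for n by simp
    obtain k where k: "k \<le> N" "fst (run (seg g N)) = seg (\<lambda>i. g (k + i)) (N - k)"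
      using fst_run_seg by blast
    have "fst (run (seg g (N + n))) = seg (\<lambda>i. g (k + i)) (N - k + n)" for n
    proof (induction n)
      case (Suc n)
      then show ?case using N[of n] k(1) by simp
    qed (simp add: k)
    with N have "T (seg (\<lambda>i. g (k + i)) (N - k + n))" for n by metis
    then have "T (seg (\<lambda>i. g (k + i)) n)" for n
      using seg_le[of n "N - k + n" "\<lambda>i. g (k + i)"] T_append by (metis le_add2)
    then have "(\<lambda>i. g (k + i)) \<in> P" by (simp add: P_iff)
    moreover have "computable (\<lambda>i. g (k + i))"
      by (rule computable_on_computable[OF _ comp, of "\<lambda>g i. g (k + i)"])
        (intro computable_on_oracle computable_on_add computable_on_basic)
    ultimately show False using P_special by blast
  next
    case False
    define t where "t n = snd (run (seg g n))" for n
    have unbounded: "\<exists>n. i < length (t n)" for i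
    proof (induction i)
      case 0
      from False obtain n where "\<not> T (fst (run (seg g n)))" by blast
      then show ?case by (intro exI[of _ "Suc n"]) (simp add: t_def)
    next
      case (Suc i)
      then obtain m where m: "i < length (t m)" by blast
      from False obtain n where n: "m \<le> n" "\<not> T (fst (run (seg g n)))" by blast
      obtain u where "seg g n = u @ seg g m" using seg_le[OF n(1)] by blast
      then obtain v where "t n = v @ t m" using snd_run_append[of u "seg g m"] by (auto simp: t_def)
      with m n(2) show ?case by (intro exI[of _ "Suc n"]) (simp add: t_def)
    qed
    \<comment> \<open>The limit of the growing strings \<open>t n\<close>: bit \<open>i\<close> is
      read at the first stage that has recorded it, which exists by
      \<open>unbounded\<close>.\<close>
    define f where "f i = the (look (t (LEAST n. i < length (t n))) i)" for i
    have look_t: "look (t n) i = Some (f i)" if i: "i < length (t n)" for n i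
    proof -
      let ?m = "LEAST n. i < length (t n)"
      have "?m \<le> n" using i by (rule Least_le)
      then obtain u where "seg g n = u @ seg g ?m" using seg_le by blast
      then obtain v where "t n = v @ t ?m" using snd_run_append[of u "seg g ?m"] by (auto simp: t_def)
      moreover have m: "i < length (t ?m)" using i by (rule LeastI)
      ultimately have "look (t n) i = look (t ?m) i" by (simp add: look_def nth_append)
      with m show ?thesis unfolding f_def by (simp add: look_def)
    qed
    have "T (seg f m)" for m
    proof -
      obtain n where n: "m < length (t n)" using unbounded by blast
      have "\<exists>u. t n = u @ seg f m" by (rule suffix_seg) (use n in \<open>auto intro: look_t\<close>)
      then show ?thesis using T[of n] T_append by (auto simp: t_def)
    qed
    then have "f \<in> P" by (simp add: P_iff)
    moreover have "computable f"
    proof (rule computable_on_computable[OF _ comp, of "\<lambda>_. f"])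
      \<comment> \<open>On the class \<open>{g}\<close> the oracle is \<open>g\<close> itself, so
        \<open>t\<close>, defined from \<open>g\<close>, can be computed from it.\<close>
      have *: "computable_on {g} (\<lambda>h x. list_encode (t (N h x)))" if "computable_on {g} N" for N
      proof -
        have "computable_on {g} (\<lambda>h x. list_encode (snd (run (seg h (N h x)))))"
          by (intro computable_on_run computable_on_seg computable_on_oracle computable_on_basic that)
        then show ?thesis by (simp add: t_def computable_on_def)
      qed
      have "computable_on {g} (\<lambda>h i. enc_opt (look (t (LEAST n. i < length (t n))) i) - 1)"
        by (intro computable_on_pred computable_on_look * computable_on_Least computable_on_less
          computable_on_length computable_on_basic unbounded)
      moreover have "enc_opt (look (t (LEAST n. i < length (t n))) i) - 1 = f i" for i
        using LeastI_ex[OF unbounded, of i] by (simp add: look_t)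
      ultimately show "computable_on {g} (\<lambda>_. f)" by simp
    qed
    ultimately show False using P_special by blast
  qed
qed

end

subsection \<open>Cancellation\<close>

text \<open>Approximates \<open>fun_join g h\<close> for \<open>g\<close> extending
  \<open>l\<close>. Only the even half is finite: \<open>h\<close> is the oracle of the search and
  fully available.\<close>

definition look_join :: "nat list \<Rightarrow> (nat \<Rightarrow> nat) \<Rightarrow> nat \<Rightarrow> nat option" where
  "look_join l h i = (if even i then look l (i div 2) else Some (h (i div 2)))"

lemma look_join_append: "look_join w h \<subseteq>\<^sub>m look_join (u @ w) h"
  using look_append[of w u] by (auto simp: map_le_def look_join_def dom_def)

lemma look_join_cat: "look_join w h \<subseteq>\<^sub>m Some \<circ> fun_join (cat w p) h"
  using look_cat[of w p] by (auto simp: map_le_def look_join_def dom_def fun_join_def)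

lemma computable_on_look_join:
  assumes "computable_on X (\<lambda>g x. list_encode (L g x))" "computable_on X I"
  shows "computable_on X (\<lambda>g x. enc_opt (look_join (L g x) g (I g x)))"
  unfolding look_join_def
  by (intro computable_on_If_opt computable_on_even computable_on_look computable_on_Some
    computable_on_oracle computable_on_half assms)

context decidable_tree
begin

text \<open>Here \<open>w\<close> is the current string, in which the recorded bits are the output of \<open>e\<close> so far; \<open>l\<close> is a
  candidate for an extension that leaves the current copy of \<open>T\<close>, and \<open>s\<close> bounds the evaluation.\<close>

definition good :: "code \<Rightarrow> (nat \<Rightarrow> nat) \<Rightarrow> nat list \<Rightarrow> nat list \<Rightarrow> nat \<Rightarrow> bool" where
  "good e h w l s \<longleftrightarrow> \<not> T (fst (run l)) \<and> (\<forall>b\<in>set l. b \<le> 1) \<and>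
    length (snd (run l)) = length (snd (run w)) \<and>
    sim s (look_join l h) e (length (snd (run l))) \<noteq> None"

text \<open>A candidate \<open>k\<close> packs both unknowns of the search, the code of an extension
  and the evaluation bound \<open>psnd k\<close>, so that one \<open>Mu\<close> finds them
  together.\<close>

definition ext :: "nat list \<Rightarrow> nat \<Rightarrow> nat list" where
  "ext w k = list_decode (pfst k) @ w"

text \<open>The subtraction undoes \<open>enc_opt\<close>; for a \<open>good\<close> candidate the
  value is never \<open>None\<close>.\<close>

definition next_bit :: "code \<Rightarrow> (nat \<Rightarrow> nat) \<Rightarrow> nat list \<Rightarrow> nat \<Rightarrow> nat" where
  "next_bit e h w k =
    enc_opt (sim (psnd k) (look_join (ext w k) h) e (length (snd (run (ext w k))))) - 1"

primrec strings :: "code \<Rightarrow> (nat \<Rightarrow> nat) \<Rightarrow> nat \<Rightarrow> nat list" where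
  "strings e h 0 = []"
| "strings e h (Suc n) =
    (let w = strings e h n; k = (LEAST k. good e h w (ext w k) (psnd k)) in next_bit e h w k # ext w k)"

text \<open>The path \<open>p\<close> witnesses that the recorded string is extendible. It may
  change from stage to stage; only its first \<open>n\<close> bits, the output of \<open>e\<close>
  so far, are settled.\<close>

definition invariant :: "code \<Rightarrow> (nat \<Rightarrow> nat) \<Rightarrow> nat list \<Rightarrow> nat \<Rightarrow> bool" where
  "invariant e h w n \<longleftrightarrow> (\<forall>b\<in>set w. b \<le> 1) \<and>
    (\<exists>p\<in>P. run w = ([], seg p n) \<and> (\<forall>i<n. \<exists>s. sim s (look_join w h) e i = Some (p i)))"

section \<open>One stage of the search\<close>

context
  fixes e h
  assumes e: "\<And>g. g \<in> Q \<Longrightarrow> \<exists>f\<in>P. \<forall>n. eval (fun_join g h) e n (f n)"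
begin

text \<open>On \<open>cat w p\<close>, an element of \<open>Q\<close>, the program \<open>e\<close>
  needs only finitely many bits for its output at \<open>n\<close>. Keeping these and then following
  a computable sequence forces an exit from \<open>T\<close>, which has no computable path.\<close>

lemma invariant_good:
  assumes "invariant e h w n"
  shows "\<exists>k. good e h w (ext w k) (psnd k)"
proof -
  from assms obtain p where w: "\<forall>b\<in>set w. b \<le> 1" "run w = ([], seg p n)" and p: "p \<in> P"
    by (auto simp: invariant_def)
  from e[OF cat_mem_Q[OF w(2,1) T_seg[OF p] p]] obtain y where
    "eval (fun_join (cat w p) h) e n y" by blast
  then obtain N where N: "\<And>s \<phi>. N \<le> s \<Longrightarrow> \<forall>i<N. \<phi> i = Some (fun_join (cat w p) h i) \<Longrightarrow>
      sim s \<phi> e n = Some y" using sim_complete by blast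
  have "look_join (seg p N @ w) h i = Some (fun_join (cat w p) h i)" if "i < N" for i
    using that look_seg[of "cat w p" "length w + N" "i div 2"]
    by (auto simp: look_join_def fun_join_def seg_cat)
  then have y: "sim N (look_join (seg p N @ w) h) e n = Some y" by (intro N) auto
  \<comment> \<open>\<open>q\<close> keeps the bits of \<open>p\<close> that may be used and is 0
    afterwards, hence computable.\<close>
  define q where "q i = (if i < N then p i else 0)" for i
  have "computable q"
  proof -
    have "\<exists>c. \<forall>x. eval (\<lambda>_. 0) c x (if x < N then p x else 0)"
    proof (induction N)
      case 0
      then show ?case by (auto intro: eval.Zero)
    next
      case (Suc N)
      then have "computable_on {\<lambda>_. 0} (\<lambda>_ x. if x < N then p x else 0)"
        by (simp add: computable_on_def)
      then have "computable_on {\<lambda>_. 0} (\<lambda>_ x. if x = N then p N else if x < N then p x else 0)"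
        by (rule computable_on_If[OF computable_on_eq[OF computable_on_id computable_on_const]
          computable_on_const])
      moreover have "(if x = N then p N else if x < N then p x else 0) =
        (if x < Suc N then p x else 0)" for x by auto
      ultimately show ?case by (simp add: computable_on_def)
    qed
    then show ?thesis by (simp add: computable_def q_def)
  qed
  then have "\<exists>m. \<not> T (seg q m)" using P_special P_iff by blast
  \<comment> \<open>By minimality, \<open>seg q m\<close> without its newest bit is still in
    \<open>T\<close>, as \<open>run_append\<close> demands.\<close>
  define m where "m = (LEAST m. \<not> T (seg q m))"
  have m: "\<not> T (seg q m)" unfolding m_def using \<open>\<exists>m. \<not> T (seg q m)\<close> by (rule LeastI_ex)
  have seg_N: "seg q N = seg p N" by (rule seg_cong) (simp add: q_def)
  \<comment> \<open>Since \<open>seg p N\<close> is in \<open>T\<close>, the exit comes after the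
    used bits.\<close>
  have "N \<le> m"
  proof (rule ccontr)
    assume "\<not> N \<le> m"
    then show False using m seg_le[of m N q] T_seg[OF p, of N] T_append seg_N by (metis nat_le_linear)
  qed
  then obtain v where v: "seg q m = v @ seg p N" using seg_le seg_N by metis
  obtain m' where m': "m = Suc m'" using m T_Nil by (cases m) auto
  have "T (seg q m')" using not_less_Least[of m' "\<lambda>m. \<not> T (seg q m)"] m' by (auto simp: m_def)
  then have run: "run (seg q m @ w) = (seg q m, seg p n)"
    by (intro run_append[OF w(2)]) (simp add: m')
  have bin: "\<forall>b\<in>set (seg q m @ w). b \<le> 1"
    using w(1) P_binary[OF p] by (auto simp: set_seg q_def)
  have "look_join (seg p N @ w) h \<subseteq>\<^sub>m look_join (seg q m @ w) h"
    unfolding v append_assoc by (rule look_join_append)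
  from sim_mono[OF this order_refl y] have "sim N (look_join (seg q m @ w) h) e n = Some y" .
  then have "good e h w (ext w (prod_encode (list_encode (seg q m), N)))
      (psnd (prod_encode (list_encode (seg q m), N)))"
    using run m bin w(2) by (simp add: good_def ext_def)
  then show ?thesis by blast
qed

text \<open>The output found on \<open>ext w k\<close> is shared by all elements of \<open>Q\<close>
  extending this string. One of them, continued along the old path \<open>p\<close>, has its image
  \<open>f\<close> in \<open>P\<close>; the recorded bits, including the new one, agree with
  \<open>f\<close>, which becomes the new witness.\<close>

lemma invariant_step:
  assumes inv: "invariant e h w n" and good: "good e h w (ext w k) (psnd k)"
  shows "invariant e h (next_bit e h w k # ext w k) (Suc n)"
    and "snd (run (next_bit e h w k # ext w k)) = next_bit e h w k # snd (run w)"
proof -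
  let ?l = "ext w k" and ?b = "next_bit e h w k"
  from inv obtain p where w: "run w = ([], seg p n)" and p: "p \<in> P"
    and sim_w: "\<And>i. i < n \<Longrightarrow> \<exists>s. sim s (look_join w h) e i = Some (p i)"
    by (auto simp: invariant_def)
  from good have l: "\<not> T (fst (run ?l))" "\<forall>b\<in>set ?l. b \<le> 1"
    "length (snd (run ?l)) = length (snd (run w))" by (auto simp: good_def)
  obtain v where "snd (run ?l) = v @ snd (run w)"
    unfolding ext_def using snd_run_append by blast
  with l(3) w have run_l: "snd (run ?l) = seg p n" by simp
  with good have b: "sim (psnd k) (look_join ?l h) e n = Some ?b"
    by (auto simp: good_def next_bit_def)
  \<comment> \<open>The bit \<open>p n\<close> is a placeholder that keeps the recorded string
    extendible; it may differ from \<open>?b\<close>.\<close>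
  let ?v = "p n # ?l"
  have run_v: "run ?v = ([], seg p (Suc n))" using l(1) run_l by simp
  have "cat ?v p \<in> Q"
    using l(2) P_binary[OF p] by (intro cat_mem_Q[OF run_v _ T_seg[OF p] p]) auto
  then obtain f where f: "f \<in> P" "\<And>i. eval (fun_join (cat ?v p) h) e i (f i)" using e by blast
  have sound: "f i = y" if "sim s (look_join ?l h) e i = Some y" for s i y
  proof -
    have "sim s (look_join ?v h) e i = Some y"
      using sim_mono[OF look_join_append order_refl that, of "[p n]"] by simp
    from eval_deterministic[OF f(2) sim_sound[OF look_join_cat this]] show ?thesis .
  qed
  have sim_l: "\<exists>s. sim s (look_join ?l h) e i = Some (p i)" if "i < n" for i
    using sim_w[OF that] sim_mono[OF look_join_append order_refl] unfolding ext_def by blast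
  have fn: "f n = ?b" using sound b by blast
  have fp: "f i = p i" if "i < n" for i using sound sim_l[OF that] by blast
  have seg_f: "seg f (Suc n) = ?b # seg p n" using fn seg_cong[of n f p] fp by simp
  have run: "run (?b # ?l) = ([], seg f (Suc n))" using l(1) run_l seg_f by simp
  then show "snd (run (?b # ?l)) = ?b # snd (run w)" using seg_f w by simp
  have "\<exists>s. sim s (look_join (?b # ?l) h) e i = Some (f i)" if i: "i < Suc n" for i
  proof -
    have "\<exists>s. sim s (look_join ?l h) e i = Some (f i)"
      using i b fn fp sim_l[of i] by (cases "i = n") auto
    then show ?thesis using sim_mono[OF look_join_append[of ?l h "[?b]"] order_refl] by fastforce
  qed
  moreover have "?b \<le> 1" using fn P_binary[OF f(1), of n] by simp
  ultimately show "invariant e h (?b # ?l) (Suc n)"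
    unfolding invariant_def using run f(1) l(2) by auto
qed

lemma invariant_strings: "invariant e h (strings e h n) n"
proof (induction n)
  case 0
  then show ?case using P_nonempty by (auto simp: invariant_def)
next
  case (Suc n)
  show ?case unfolding strings.simps Let_def
    by (rule invariant_step(1)[OF Suc LeastI_ex[OF invariant_good[OF Suc]]])
qed

text \<open>Each stage records exactly one bit, the head of its string, so the heads spell out the
  limit of the recorded strings, all of which lie in \<open>T\<close>.\<close>

lemma strings_mem_P: "(\<lambda>n. hd (strings e h (Suc n))) \<in> P"
proof -
  let ?f = "\<lambda>n. hd (strings e h (Suc n))"
  have step: "snd (run (strings e h (Suc n))) = ?f n # snd (run (strings e h n))" for n
    using invariant_step(2)[OF invariant_strings LeastI_ex[OF invariant_good[OF invariant_strings]], of n]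
    unfolding strings.simps Let_def by simp
  have "snd (run (strings e h n)) = seg ?f n" for n
  proof (induction n)
    case (Suc n)
    then show ?case unfolding step by simp
  qed simp
  moreover have "T (snd (run (strings e h n)))" for n
    using invariant_strings[of n] T_seg by (auto simp: invariant_def)
  ultimately show ?thesis by (simp add: P_iff)
qed

end

section \<open>Computability of the reduction\<close>

lemma computable_on_ext:
  assumes "computable_on X A" "computable_on X B"
  shows "computable_on X (\<lambda>g x. list_encode (ext (list_decode (A g x)) (B g x)))"
  unfolding ext_def by (intro computable_on_append computable_on_list_decode computable_on_basic assms)

text \<open>The strings arise by an iterated search with oracle \<open>h\<close> alone; for
  \<open>h\<close> in \<open>C\<close> the invariant makes every search succeed at the states
  actually reached.\<close>

lemma medvedev_le_cancel:
  assumes "medvedev_le P (set_join Q C)"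
  shows "medvedev_le P C"
proof -
  from assms obtain e where "\<forall>k\<in>set_join Q C. \<exists>f\<in>P. \<forall>n. eval k e n (f n)"
    unfolding medvedev_le_iff by blast
  then have e: "\<And>g h. h \<in> C \<Longrightarrow> g \<in> Q \<Longrightarrow> \<exists>f\<in>P. \<forall>n. eval (fun_join g h) e n (f n)"
    unfolding set_join_def by blast
  define p where "p h x k \<longleftrightarrow> good e h (list_decode x) (ext (list_decode x) k) (psnd k)" for h x k
  define G where "G h x k = list_encode (next_bit e h (list_decode x) k # ext (list_decode x) k)" for h x k
  note rules = computable_on_conj computable_on_not computable_on_T computable_on_run computable_on_ext
    computable_on_binary computable_on_eq computable_on_length computable_on_list_decode
    computable_on_pred computable_on_Cons computable_on_sim computable_on_look_join computable_on_basic
  have *: "r \<noteq> None \<longleftrightarrow> enc_opt r \<noteq> 0" for r by (cases r) auto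
  have "computable_on C (\<lambda>h n. list_encode (strings e h n))"
  proof (rule computable_on_search_iterate[where p = p and G = G])
    show "computable_on C (\<lambda>h z. of_bool (p h (pfst z) (psnd z)))"
      unfolding p_def good_def * by (intro rules)
    show "computable_on C (\<lambda>h z. G h (pfst z) (psnd z))"
      unfolding G_def next_bit_def by (intro rules)
    show "\<exists>k. p h (list_encode (strings e h n)) k" if "h \<in> C" for h n
      unfolding p_def list_encode_inverse
      by (rule invariant_good[OF e[OF that] invariant_strings[OF e[OF that]]])
    show "list_encode (strings e h (Suc n)) = G h (list_encode (strings e h n))
      (LEAST k. p h (list_encode (strings e h n)) k)" for h n
      by (simp add: p_def G_def Let_def)
  qed (rule arg_cong[of _ _ list_encode], simp)
  from computable_on_comp[OF this computable_on_Suc[OF computable_on_id]]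
  have "computable_on C (\<lambda>h n. pfst (list_encode (strings e h (Suc n)) - 1))"
    by (intro computable_on_pfst computable_on_pred)
  moreover have "pfst (list_encode (strings e h (Suc n)) - 1) = hd (strings e h (Suc n))" for h n
    by (simp add: Let_def)
  ultimately have "computable_on C (\<lambda>h n. hd (strings e h (Suc n)))" by simp
  then obtain c where "\<forall>h\<in>C. \<forall>n. eval h c n (hd (strings e h (Suc n)))"
    unfolding computable_on_def by blast
  moreover have "(\<lambda>n. hd (strings e h (Suc n))) \<in> P" if "h \<in> C" for h
    by (rule strings_mem_P[OF e[OF that]])
  ultimately show ?thesis
    unfolding medvedev_le_iff
    by (intro exI[of _ c] ballI bexI[of _ "\<lambda>n. hd (strings e h (Suc n))" for h]) auto
qed

end

section \<open>Transfer to degrees\<close>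

theorem corollary33:
  fixes a :: degree
  assumes "a \<in> P11" and "a \<noteq> bot"
  shows "strong_anticupping a"
proof -
  from assms(1) obtain P R where a: "a = abs_degree P" and P: "P \<noteq> {}" "P \<subseteq> cantor_space"
    and R: "computable_relation R" "P = {f. \<forall>n. R f n}"
    unfolding P11_def pi01_def by blast
  from R(1) obtain c where c: "\<And>f n. eval f c n (of_bool (R f n))"
    unfolding computable_relation_def by blast
  interpret decidable_tree "pi01_tree c" P
  proof
    show "pi01_tree c w" if "pi01_tree c (u @ w)" for u w
      using that by (rule pi01_tree_append)
    show "b \<le> 1" if "pi01_tree c l" "b \<in> set l" for b l
      using that by (auto simp: pi01_tree_def)
    show "f \<in> P \<longleftrightarrow> (\<forall>n. pi01_tree c (seg f n))" for f
      using pi01_tree_seg_iff[of c R f, OF c] R(2) P(2) by auto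
    \<comment> \<open>A computable element of \<open>P\<close> would make \<open>a\<close> the zero
      degree.\<close>
    show "\<not> computable f" if "f \<in> P" for f
      using that assms(2) unfolding a abs_degree_eq_bot_iff by blast
  qed (use P(1) computable_on_pi01_tree in auto)
  have "abs_degree Q \<in> P11"
    unfolding P11_def using Q_nonempty pi01_Q by (auto simp: Q_def)
  moreover have "abs_degree Q \<noteq> bot"
    unfolding abs_degree_eq_bot_iff using Q_special by blast
  moreover have "a \<le> d" if "a \<le> sup (abs_degree Q) d" for d
  proof -
    obtain C where d: "d = abs_degree C" by (metis Quotient3_abs_rep Quotient3_degree)
    from that show ?thesis
      unfolding a d sup_degree.abs_eq less_eq_degree.abs_eq by (rule medvedev_le_cancel)
  qed
  ultimately show ?thesis unfolding strong_anticupping_def by blast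
qed

end
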